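(* Let $G$ be a finite-dimensional Lie group and consider the discrete-time optimal control problem of minimizing $J=\sum_{k=0}^{H-1}\Lambda^k(g^k,u^k)+F(g^H)$ over control sequences $u^0,\dots,u^{H-1}\in\mathbb{R}^m$, subject to $g^{k+1}=f^k(g^k,u^k)$ and $g^0=\bar g^0$ fixed. Let $\bar U=(\bar u^0,\dots,\bar u^{H-1})$ be a nominal control sequence with nominal state trajectory $\{\bar g^k\}_{k=0}^H$. Let $Q_u^k$, $Q_{uu}^k$, $Q_{gu}^k$ be the DDP quantities along $(\{\bar g^k\},\{\bar u^k\})$ defined in the context, with every $Q_{uu}^k$ invertible. For $\gamma\in(0,1]$ let $\delta U_\star=(\delta u^0_\star,\dots,\delta u^{H-1}_\star)$ be the DDP control updates $$\delta u^k_\star=-\gamma (Q_{uu}^k)^{-1}Q_u^k-(Q_{uu}^k)^{-1}Q_{gu}^k(\zeta^k),\qquad k=0,\dots,H-1,$$ where $\zeta^0=0$ and $\zeta^k$ is the state perturbation generated by the updated controls, as defined in the context. Then, as $\gamma\to 0^+$, $$\mathsf{D}_U|_{\bar U}J\cdot\delta U_\star=-\gamma\sum_{i=0}^{H-1}\big\langle Q_u^i,(Q_{uu}^i)^{-1}(Q_u^i)\big\rangle+O(\gamma^2).$$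
   Context: **Setting.** $G$ is a finite-dimensional Lie group with identity $e$, Lie algebra $\mathfrak g=T_eG$ and dual $\mathfrak g^*$. $L_g$ is left translation, $T_eL_g:\mathfrak g\to T_gG$ its tangent map, and $T_eL_g^*$ the dual map. $\langle\cdot,\cdot\rangle$ is the natural pairing of a dual space with its vector space. For a linear map $A:V\to W$, $A^*:W^*\to V^*$ is its dual. $\exp:\mathfrak g\to G$ is the exponential map and $\log$ its local inverse near $e$. The data are $f^k:G\times\mathbb{R}^m\to G$, $\Lambda^k:G\times\mathbb{R}^m\to\mathbb{R}$ ($k=0,\dots,H-1$) and $F:G\to\mathbb{R}$. Standing assumptions: the optimal control problem admits a solution, and $J$ and all $f^k$ are twice differentiable. In $\mathsf D_U|_{\bar U}J$, $J$ is regarded as a function of the control sequence $U\in\mathbb{R}^{mH}$ alone, the states being determined by $g^{k+1}=f^k(g^k,u^k)$, $g^0=\bar g^0$. The nominal trajectory is $\bar g^{k+1}=f^k(\bar g^k,\bar u^k)$. **Expansion of the dynamics.** For $(\zeta,\upsilon)\in\mathfrak g\times\mathbb{R}^m$ near $(0,0)$, the map $(\zeta,\upsilon)\mapsto\log\big((\bar g^{k+1})^{-1}f^k(\bar g^k\exp(\zeta),\bar u^k+\upsilon)\big)$ has the second-order Taylor expansion at $(0,0)$ $$\Phi^k(\zeta)+\mathrm B^k(\upsilon)+\tfrac12\big(\Theta^k(\zeta)(\zeta)+\Gamma^k(\zeta)(\upsilon)+\Delta^k(\upsilon)(\zeta)+\Xi^k(\upsilon)(\upsilon)\big),$$ with $\Phi^k:\mathfrak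 g\to\mathfrak g$ and $\mathrm B^k:\mathbb{R}^m\to\mathfrak g$ linear, $\Theta^k:\mathfrak g\times\mathfrak g\to\mathfrak g$ and $\Xi^k:\mathbb{R}^m\times\mathbb{R}^m\to\mathfrak g$ symmetric bilinear, and $\Gamma^k:\mathfrak g\times\mathbb{R}^m\to\mathfrak g$, $\Delta^k:\mathbb{R}^m\times\mathfrak g\to\mathfrak g$ bilinear with $\Delta^k(\upsilon)(\zeta)=\Gamma^k(\zeta)(\upsilon)$. **Trivialized derivatives of the costs.** For twice differentiable $\mathsf f:G\to\mathbb{R}$, $\mathrm{Hess}^{(0)}\mathsf f(g)$ is the Hessian for the $(0)$ Cartan–Schouten connection, i.e. for $x,y\in\mathfrak g$ with left-invariant vector fields $gx,gy$, $\mathrm{Hess}^{(0)}\mathsf f(g)(gx)(gy)=\tfrac12\big((gx)(gy)+(gy)(gx)\big)(\mathsf f)(g)$. All evaluated at $(\bar g^k,\bar u^k)$: $\ell_g^k=T_eL_{g^k}^*\circ\mathsf D_g\Lambda^k$, $\ell_u^k=\mathsf D_u\Lambda^k$, $\ell_{uu}^k=\mathsf D_u^2\Lambda^k$, $\ell_{gu}^k=\mathsf D_g\mathsf D_u\Lambda^k\circ T_eL_{g^k}:\mathfrak g\to(\mathbb{R}^m)^*$, $\ell_{ug}^k=T_eL_{g^k}^*\circ\mathsf D_u\mathsf D_g\Lambda^k=(\ell_{gu}^k)^*:\mathbb{R}^m\to\mathfrak g^*$, $\ell_{gg}^k=T_eL_{g^k}^*\circ\mathrm{Hess}_g^{(0)}\Lambda^k\circ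 T_eL_{g^k}:\mathfrak g\to\mathfrak g^*$. **Backward pass.** Set $\mathcal V_g^H=T_eL_{\bar g^H}^*\circ\mathsf DF(\bar g^H)\in\mathfrak g^*$ and $\mathcal V_{gg}^H=T_eL_{\bar g^H}^*\circ\mathrm{Hess}^{(0)}F(\bar g^H)\circ T_eL_{\bar g^H}:\mathfrak g\to\mathfrak g^*$. For $k=H-1,\dots,0$ define - $Q_g^k=\ell_g^k+(\Phi^k)^*\mathcal V_g^{k+1}\in\mathfrak g^*$, $\;Q_u^k=\ell_u^k+(\mathrm B^k)^*\mathcal V_g^{k+1}\in(\mathbb{R}^m)^*$; - $Q_{gg}^k=\ell_{gg}^k+(\Phi^k)^*\mathcal V_{gg}^{k+1}\Phi^k+\mathcal V_g^{k+1}\circ\Theta^k:\mathfrak g\to\mathfrak g^*$; - $Q_{gu}^k=\ell_{gu}^k+(\mathrm B^k)^*\mathcal V_{gg}^{k+1}\Phi^k+\mathcal V_g^{k+1}\circ\Gamma^k:\mathfrak g\to(\mathbb{R}^m)^*$; - $Q_{ug}^k=\ell_{ug}^k+(\Phi^k)^*\mathcal V_{gg}^{k+1}\mathrm B^k+\mathcal V_g^{k+1}\circ\Delta^k:\mathbb{R}^m\to\mathfrak g^*$; - $Q_{uu}^k=\ell_{uu}^k+(\mathrm B^k)^*\mathcal V_{gg}^{k+1}\mathrm B^k+\mathcal V_g^{k+1}\circ\Xi^k:\mathbb{R}^m\to(\mathbb{R}^m)^*$; where e.g. $\mathcal V_g^{k+1}\circ\Theta^k$ sends $\zeta$ to the functional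 $\zeta'\mapsto\mathcal V_g^{k+1}(\Theta^k(\zeta)(\zeta'))$, and similarly for the others. Then $$\mathcal V_g^k=Q_g^k-Q_{ug}^k(Q_{uu}^k)^{-1}Q_u^k,\qquad \mathcal V_{gg}^k=Q_{gg}^k-Q_{ug}^k(Q_{uu}^k)^{-1}Q_{gu}^k.$$ **Forward pass (definition of $\zeta^k$).** For given $\gamma$: $g^0=\bar g^0$, $\zeta^0=0$, and recursively $u^k=\bar u^k+\delta u_\star^k$, $g^{k+1}=f^k(g^k,u^k)$, $\zeta^{k+1}=\log\big((\bar g^{k+1})^{-1}g^{k+1}\big)$ (well defined for all small enough $\gamma$). The nominal data are fixed as $\gamma\to0^+$. *)

theory Defs
  imports "HOL-Analysis.Analysis" "HOL-Algebra.Group" "HOL-Library.Landau_Symbols"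
begin

text \<open>Frechet derivatives as bounded linear maps; the dual of a normed space is \<open>_ \<Rightarrow>\<^sub>L real\<close>.\<close>

definition fderiv ::
    "('a::real_normed_vector \<Rightarrow> 'b::real_normed_vector) \<Rightarrow> 'a \<Rightarrow> 'a \<Rightarrow>\<^sub>L 'b"
  where "fderiv f x = Blinfun (frechet_derivative f (at x))"

definition dual_map ::
    "('a::real_normed_vector \<Rightarrow>\<^sub>L 'b::real_normed_vector) \<Rightarrow> ('b \<Rightarrow>\<^sub>L real) \<Rightarrow>\<^sub>L ('a \<Rightarrow>\<^sub>L real)"
  where "dual_map A = Blinfun (\<lambda>\<phi>. \<phi> o\<^sub>L A)"

text \<open>For a functional \<open>V\<close> and a bilinear map \<open>T\<close>: \<open>x \<mapsto> (y \<mapsto> V (T x y))\<close>.\<close>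

definition functional_after ::
    "('c::real_normed_vector \<Rightarrow>\<^sub>L real) \<Rightarrow>
     ('a::real_normed_vector \<Rightarrow>\<^sub>L 'b::real_normed_vector \<Rightarrow>\<^sub>L 'c) \<Rightarrow> 'a \<Rightarrow>\<^sub>L 'b \<Rightarrow>\<^sub>L real"
  where "functional_after V T = Blinfun (\<lambda>x. V o\<^sub>L T x)"

definition binv ::
    "('a::real_normed_vector \<Rightarrow>\<^sub>L 'b::real_normed_vector) \<Rightarrow> 'b \<Rightarrow>\<^sub>L 'a"
  where "binv A = Blinfun (inv_into UNIV (blinfun_apply A))"

text \<open>The domain is finite-dimensional, so a map is \<open>n + 1\<close> times differentiable iff it is
  differentiable and all its directional derivatives are \<open>n\<close> times differentiable.
  The derivative of highest order is not required to be continuous.\<close>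

fun times_differentiable_on ::
    "nat \<Rightarrow> ('a::euclidean_space \<Rightarrow> 'b::real_normed_vector) \<Rightarrow> 'a set \<Rightarrow> bool"
  where
    "times_differentiable_on 0 f S \<longleftrightarrow> True"
  | "times_differentiable_on (Suc n) f S \<longleftrightarrow>
       (\<forall>x\<in>S. f differentiable (at x)) \<and>
       (\<forall>v. times_differentiable_on n (\<lambda>x. frechet_derivative f (at x) v) S)"

definition smooth_on ::
    "('a::euclidean_space \<Rightarrow> 'b::real_normed_vector) \<Rightarrow> 'a set \<Rightarrow> bool"
  where "smooth_on f S \<longleftrightarrow> (\<forall>n. times_differentiable_on n f S)"

text \<open>A chart is a pair of its domain and its coordinate map, the latter being relevant on the
  domain only.\<close>

type_synonym ('g, 'e) chart = "'g set \<times> ('g \<Rightarrow> 'e)"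

definition chart_inv :: "('g, 'e) chart \<Rightarrow> 'e \<Rightarrow> 'g"
  where "chart_inv c = inv_into (fst c) (snd c)"

definition is_chart :: "('g::topological_space, 'e::euclidean_space) chart \<Rightarrow> bool"
  where "is_chart c \<longleftrightarrow> open (fst c) \<and> open (snd c ` fst c) \<and>
    homeomorphism (fst c) (snd c ` fst c) (snd c) (chart_inv c)"

definition smooth_atlas :: "('g::topological_space, 'e::euclidean_space) chart set \<Rightarrow> bool"
  where "smooth_atlas A \<longleftrightarrow> (\<forall>c\<in>A. is_chart c) \<and> (\<Union>c\<in>A. fst c) = UNIV \<and>
    (\<forall>c\<in>A. \<forall>d\<in>A. smooth_on (snd d \<circ> chart_inv c) (snd c ` (fst c \<inter> fst d)))"

definition std_atlas :: "('e, 'e) chart set"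
  where "std_atlas = {(UNIV, id)}"

definition prod_atlas ::
    "('g, 'e) chart set \<Rightarrow> ('h, 'f) chart set \<Rightarrow> ('g \<times> 'h, 'e \<times> 'f) chart set"
  where "prod_atlas A B = {(fst c \<times> fst d, map_prod (snd c) (snd d)) | c d. c \<in> A \<and> d \<in> B}"

definition times_differentiable_map ::
    "nat \<Rightarrow> ('g::topological_space, 'e::euclidean_space) chart set \<Rightarrow>
     ('h::topological_space, 'f::euclidean_space) chart set \<Rightarrow> ('g \<Rightarrow> 'h) \<Rightarrow> bool"
  where "times_differentiable_map n A B f \<longleftrightarrow> continuous_on UNIV f \<and>
    (\<forall>c\<in>A. \<forall>d\<in>B.
       times_differentiable_on n (snd d \<circ> f \<circ> chart_inv c) (snd c ` (fst c \<inter> f -` fst d)))"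

definition smooth_map ::
    "('g::topological_space, 'e::euclidean_space) chart set \<Rightarrow>
     ('h::topological_space, 'f::euclidean_space) chart set \<Rightarrow> ('g \<Rightarrow> 'h) \<Rightarrow> bool"
  where "smooth_map A B f \<longleftrightarrow> (\<forall>n. times_differentiable_map n A B f)"

record ('g, 'e) lie_group_data = "'g monoid" +
  atlas :: "('g, 'e) chart set"

locale lie_group = group G
  for G :: "('g::{t2_space, second_countable_topology}, 'e::euclidean_space) lie_group_data"
    (structure) +
  assumes carrier_UNIV: "carrier G = UNIV"
    and smooth_atlas: "smooth_atlas (atlas G)"
    and smooth_mult: "smooth_map (prod_atlas (atlas G) (atlas G)) (atlas G) (\<lambda>(g, h). g \<otimes> h)"
    and smooth_inv: "smooth_map (atlas G) (atlas G) (\<lambda>g. inv g)"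

text \<open>Every point \<open>p\<close> is given one preferred chart of the atlas around it, and the tangent space
  at \<open>p\<close> is identified with the model space \<open>'e\<close> through that chart. In particular the Lie algebra,
  the tangent space at the identity, is \<open>'e\<close>.\<close>

definition chart_at :: "('g, 'e) lie_group_data \<Rightarrow> 'g \<Rightarrow> ('g, 'e) chart"
  where "chart_at G p = (SOME c. c \<in> atlas G \<and> p \<in> fst c)"

definition coord :: "('g, 'e) lie_group_data \<Rightarrow> 'g \<Rightarrow> 'g \<Rightarrow> 'e"
  where "coord G p = snd (chart_at G p)"

definition coord_inv :: "('g, 'e) lie_group_data \<Rightarrow> 'g \<Rightarrow> 'e \<Rightarrow> 'g"
  where "coord_inv G p = chart_inv (chart_at G p)"

text \<open>Differential at \<open>p\<close> of a map from the group to a normed space.\<close>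

definition diff_at ::
    "('g, 'e::euclidean_space) lie_group_data \<Rightarrow> ('g \<Rightarrow> 'b::real_normed_vector) \<Rightarrow> 'g \<Rightarrow> 'e \<Rightarrow>\<^sub>L 'b"
  where "diff_at G f p = fderiv (f \<circ> coord_inv G p) (coord G p p)"

text \<open>\<open>T\<^sub>eL\<^sub>g\<close>, the tangent map at the identity of left translation by \<open>g\<close>.\<close>

definition left_trans_tangent :: "('g, 'e::euclidean_space) lie_group_data \<Rightarrow> 'g \<Rightarrow> 'e \<Rightarrow>\<^sub>L 'e"
  where "left_trans_tangent G g =
    fderiv (coord G g \<circ> (\<lambda>h. g \<otimes>\<^bsub>G\<^esub> h) \<circ> coord_inv G \<one>\<^bsub>G\<^esub>) (coord G \<one>\<^bsub>G\<^esub> \<one>\<^bsub>G\<^esub>)"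

text \<open>Curves that solve \<open>c' = T\<^sub>eL\<^sub>c x\<close> with \<open>c 0\<close> the identity. Continuity has to be demanded
  separately because coordinate maps are arbitrary off their domains.\<close>

definition exp_curve ::
    "('g::topological_space, 'e::euclidean_space) lie_group_data \<Rightarrow> 'e \<Rightarrow> (real \<Rightarrow> 'g) \<Rightarrow> bool"
  where "exp_curve G x c \<longleftrightarrow> c 0 = \<one>\<^bsub>G\<^esub> \<and> continuous_on UNIV c \<and>
    (\<forall>t. ((coord G (c t) \<circ> c) has_vector_derivative left_trans_tangent G (c t) x) (at t))"

definition lie_exp ::
    "('g::topological_space, 'e::euclidean_space) lie_group_data \<Rightarrow> 'e \<Rightarrow> 'g"
  where "lie_exp G x = (THE c. exp_curve G x c) 1"

text \<open>Any two local inverses agree near the identity; the values of \<open>lg\<close> off \<open>V\<close> are arbitrary.\<close>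

definition local_log ::
    "('g::topological_space, 'e::euclidean_space) lie_group_data \<Rightarrow> ('g \<Rightarrow> 'e) \<Rightarrow> bool"
  where "local_log G lg \<longleftrightarrow> (\<exists>U V. open U \<and> 0 \<in> U \<and> open V \<and> \<one>\<^bsub>G\<^esub> \<in> V \<and>
    homeomorphism U V (lie_exp G) lg)"

text \<open>The left-invariant vector field \<open>g \<mapsto> gx\<close>, acting on functions.\<close>

definition left_inv_field ::
    "('g, 'e::euclidean_space) lie_group_data \<Rightarrow> 'e \<Rightarrow> ('g \<Rightarrow> real) \<Rightarrow> 'g \<Rightarrow> real"
  where "left_inv_field G x f g = diff_at G f g (left_trans_tangent G g x)"

text \<open>Hessian of the (0) Cartan-Schouten connection, as a map from the tangent space at \<open>g\<close> to its
  dual; tangent vectors at \<open>g\<close> are written \<open>gx\<close> by inverting \<open>T\<^sub>eL\<^sub>g\<close>.\<close>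

definition hess0 ::
    "('g, 'e::euclidean_space) lie_group_data \<Rightarrow> ('g \<Rightarrow> real) \<Rightarrow> 'g \<Rightarrow> 'e \<Rightarrow>\<^sub>L 'e \<Rightarrow>\<^sub>L real"
  where "hess0 G f g = Blinfun (\<lambda>v. Blinfun (\<lambda>w.
    let x = binv (left_trans_tangent G g) v; y = binv (left_trans_tangent G g) w
    in (1/2) * (left_inv_field G x (left_inv_field G y f) g
              + left_inv_field G y (left_inv_field G x f) g)))"

definition triv_diff ::
    "('g, 'e::euclidean_space) lie_group_data \<Rightarrow> ('g \<Rightarrow> real) \<Rightarrow> 'g \<Rightarrow> 'e \<Rightarrow>\<^sub>L real"
  where "triv_diff G f g = dual_map (left_trans_tangent G g) (diff_at G f g)"

definition triv_hess ::
    "('g, 'e::euclidean_space) lie_group_data \<Rightarrow> ('g \<Rightarrow> real) \<Rightarrow> 'g \<Rightarrow> 'e \<Rightarrow>\<^sub>L 'e \<Rightarrow>\<^sub>L real"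
  where "triv_hess G f g =
    dual_map (left_trans_tangent G g) o\<^sub>L hess0 G f g o\<^sub>L left_trans_tangent G g"

definition cost_g ::
    "('g, 'e::euclidean_space) lie_group_data \<Rightarrow> ('g \<Rightarrow> 'u::euclidean_space \<Rightarrow> real) \<Rightarrow>
     'g \<Rightarrow> 'u \<Rightarrow> 'e \<Rightarrow>\<^sub>L real"
  where "cost_g G L g u = triv_diff G (\<lambda>h. L h u) g"

definition cost_u :: "('g \<Rightarrow> 'u::euclidean_space \<Rightarrow> real) \<Rightarrow> 'g \<Rightarrow> 'u \<Rightarrow> 'u \<Rightarrow>\<^sub>L real"
  where "cost_u L g u = fderiv (L g) u"

definition cost_uu :: "('g \<Rightarrow> 'u::euclidean_space \<Rightarrow> real) \<Rightarrow> 'g \<Rightarrow> 'u \<Rightarrow> 'u \<Rightarrow>\<^sub>L 'u \<Rightarrow>\<^sub>L real"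
  where "cost_uu L g u = fderiv (fderiv (L g)) u"

definition cost_gu ::
    "('g, 'e::euclidean_space) lie_group_data \<Rightarrow> ('g \<Rightarrow> 'u::euclidean_space \<Rightarrow> real) \<Rightarrow>
     'g \<Rightarrow> 'u \<Rightarrow> 'e \<Rightarrow>\<^sub>L 'u \<Rightarrow>\<^sub>L real"
  where "cost_gu G L g u = diff_at G (\<lambda>h. fderiv (L h) u) g o\<^sub>L left_trans_tangent G g"

definition cost_ug ::
    "('g, 'e::euclidean_space) lie_group_data \<Rightarrow> ('g \<Rightarrow> 'u::euclidean_space \<Rightarrow> real) \<Rightarrow>
     'g \<Rightarrow> 'u \<Rightarrow> 'u \<Rightarrow>\<^sub>L 'e \<Rightarrow>\<^sub>L real"
  where "cost_ug G L g u =
    dual_map (left_trans_tangent G g) o\<^sub>L fderiv (\<lambda>v. diff_at G (\<lambda>h. L h v) g) u"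

definition cost_gg ::
    "('g, 'e::euclidean_space) lie_group_data \<Rightarrow> ('g \<Rightarrow> 'u::euclidean_space \<Rightarrow> real) \<Rightarrow>
     'g \<Rightarrow> 'u \<Rightarrow> 'e \<Rightarrow>\<^sub>L 'e \<Rightarrow>\<^sub>L real"
  where "cost_gg G L g u = triv_hess G (\<lambda>h. L h u) g"

text \<open>Second-order Taylor expansion at \<open>(0, 0)\<close>, with vanishing constant term.\<close>

definition taylor2 ::
    "('a::euclidean_space \<Rightarrow> 'u::euclidean_space \<Rightarrow> 'c::real_normed_vector) \<Rightarrow>
     ('a \<Rightarrow>\<^sub>L 'c) \<Rightarrow> ('u \<Rightarrow>\<^sub>L 'c) \<Rightarrow> ('a \<Rightarrow>\<^sub>L 'a \<Rightarrow>\<^sub>L 'c) \<Rightarrow> ('a \<Rightarrow>\<^sub>L 'u \<Rightarrow>\<^sub>L 'c) \<Rightarrow>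
     ('u \<Rightarrow>\<^sub>L 'a \<Rightarrow>\<^sub>L 'c) \<Rightarrow> ('u \<Rightarrow>\<^sub>L 'u \<Rightarrow>\<^sub>L 'c) \<Rightarrow> bool"
  where "taylor2 T \<Phi> B \<Theta> \<Gamma> \<Delta> \<Xi> \<longleftrightarrow>
    (\<forall>x y. \<Theta> x y = \<Theta> y x) \<and> (\<forall>v w. \<Xi> v w = \<Xi> w v) \<and> (\<forall>x v. \<Delta> v x = \<Gamma> x v) \<and>
    (\<lambda>(x, v). norm (T x v - (\<Phi> x + B v + (1/2) *\<^sub>R (\<Theta> x x + \<Gamma> x v + \<Delta> v x + \<Xi> v v))))
      \<in> o[nhds (0, 0)](\<lambda>z. norm z ^ 2)"

primrec state :: "(nat \<Rightarrow> 'g \<Rightarrow> 'u \<Rightarrow> 'g) \<Rightarrow> 'g \<Rightarrow> (nat \<Rightarrow> 'u) \<Rightarrow> nat \<Rightarrow> 'g"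
  where
    "state f g0 u 0 = g0"
  | "state f g0 u (Suc k) = f k (state f g0 u k) (u k)"

text \<open>The total cost as a function of the control sequence alone. A sequence of length \<open>H\<close> is
  a vector over an index type with \<open>H\<close> elements, enumerated by \<open>ix\<close>, so that the space of control
  sequences is a normed space.\<close>

definition total_cost ::
    "nat \<Rightarrow> (nat \<Rightarrow> 'h::finite) \<Rightarrow> (nat \<Rightarrow> 'g \<Rightarrow> 'u \<Rightarrow> 'g) \<Rightarrow> (nat \<Rightarrow> 'g \<Rightarrow> 'u \<Rightarrow> real) \<Rightarrow>
     ('g \<Rightarrow> real) \<Rightarrow> 'g \<Rightarrow> 'u ^ 'h \<Rightarrow> real"
  where "total_cost H ix f \<Lambda> F g0 U =
    (let g = state f g0 (\<lambda>k. U $ ix k)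
     in (\<Sum>k<H. \<Lambda> k (g k) (U $ ix k)) + F (g H))"

end

theory Submission
  imports Defs
begin

text \<open>Two obstacles shape the proof. The first is symmetry. The cancellation of the feedback
  terms needs \<open>Quu\<close> symmetric and \<open>Qug\<close> dual to \<open>Qgu\<close>, and
  both depend on symmetry of \<open>Vgg\<close> at the next time; this is carried backwards from the
  Hessian of \<open>F\<close>, each step using that the inverse of a symmetric form is symmetric.
  Second derivatives exist but may be discontinuous, so their symmetry is derived from second
  differences at a single point. The second is well-definedness. \<open>Blinfun\<close>,
  \<open>THE\<close> and \<open>inv_into\<close> yield arbitrary values outside their intended use,
  and tangent spaces are read in preferred charts that can jump from point to point. Hence
  linearity, boundedness or uniqueness is established before such a term is evaluated, and
  derivatives in the base point are computed in one fixed chart. Once symmetry is available, the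
  error is, for each \<gamma> in the range, exactly a sum of fixed functionals applied to the
  difference of linearized and true state perturbation. Only this difference is estimated: both
  perturbations start at 0 and obey the same recursion up to the quadratic Taylor remainder.\<close>

text \<open>In the exponential coordinates \<open>z\<^sub>k = log (gbar\<^sub>k\<^sup>-\<^sup>1 g\<^sub>k)\<close> along the nominal trajectory the dynamics are the
  maps with the given Taylor expansions, so the derivative of \<open>J\<close> is a sum of stage terms
  \<open>\<ell>\<^sub>g \<eta>\<^sub>k + \<ell>\<^sub>u \<delta>u\<^sub>k\<close> and a terminal term, where \<open>\<eta>\<close> solves the linearized recursion with \<open>\<Phi>\<close> and \<open>B\<close>.
  Telescoping \<open>V\<^sub>g\<^sup>k \<eta>\<^sub>k\<close> turns this sum into \<open>\<Sum>\<^sub>k Q\<^sub>u \<delta>u\<^sub>k + Q\<^sub>u\<^sub>g (Q\<^sub>u\<^sub>u\<^sup>-\<^sup>1 Q\<^sub>u) \<eta>\<^sub>k\<close>. Since \<open>Q\<^sub>u\<^sub>u\<close> is symmetric and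
  \<open>Q\<^sub>u\<^sub>g\<close> is the dual of \<open>Q\<^sub>g\<^sub>u\<close>, the feedback part of the update cancels the last term up to
  \<open>Q\<^sub>u\<^sub>g (Q\<^sub>u\<^sub>u\<^sup>-\<^sup>1 Q\<^sub>u) (\<eta>\<^sub>k - \<zeta>\<^sub>k)\<close>, and \<open>\<eta>\<^sub>k - \<zeta>\<^sub>k = O(\<gamma>\<^sup>2)\<close> by induction on \<open>k\<close>.

  The trivialized derivatives match those in exponential coordinates because the derivative of the
  exponential map at \<open>0\<close> is the identity. As the logarithm is assumed to be a local inverse, this needs
  uniqueness of the curves that define the exponential map, but no existence theorem for differential
  equations.\<close>

section \<open>Derivatives in normed spaces\<close>

lemma differentiable_cong_open:
  assumes "open S" "x \<in> S" "\<And>y. y \<in> S \<Longrightarrow> f y = g y"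
  shows "f differentiable (at x) \<longleftrightarrow> g differentiable (at x)"
  using assms unfolding differentiable_def
  by (metis has_derivative_transform_within_open)

lemma frechet_derivative_cong_open:
  assumes "open S" "x \<in> S" "\<And>y. y \<in> S \<Longrightarrow> f y = g y"
  shows "frechet_derivative f (at x) = frechet_derivative g (at x)"
proof -
  have "(f has_derivative D) (at x) \<longleftrightarrow> (g has_derivative D) (at x)" for D
    using assms by (metis has_derivative_transform_within_open)
  then show ?thesis
    by (simp add: frechet_derivative_def)
qed

lemma times_differentiable_on_cong:
  assumes "open S" "\<And>x. x \<in> S \<Longrightarrow> f x = g x"
  shows "times_differentiable_on n f S \<longleftrightarrow> times_differentiable_on n g S"
  using assms(2)
proof (induction n arbitrary: f g)
  case (Suc n)
  have 1: "f differentiable (at x) \<longleftrightarrow> g differentiable (at x)" if "x \<in> S" for x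
    using differentiable_cong_open[OF assms(1) that] Suc.prems by blast
  have 2: "frechet_derivative f (at x) v = frechet_derivative g (at x) v" if "x \<in> S" for x v
    using frechet_derivative_cong_open[OF assms(1) that, of f g] Suc.prems by simp
  show ?case
    using 1 Suc.IH[OF 2] by auto
qed simp

text \<open>A derivative of the composite in direction \<open>v\<close> is a derivative of
  \<open>f\<close> in the fixed direction \<open>l v\<close>, composed with the same affine map, so
  the induction closes. The affine maps used later are the inclusions of slices with fixed control
  or fixed state.\<close>

lemma times_differentiable_on_affine:
  fixes l :: "'a::euclidean_space \<Rightarrow> 'b::euclidean_space"
  assumes "open S" and l: "bounded_linear l" and "times_differentiable_on n f S"
  shows "times_differentiable_on n (\<lambda>x. f (l x + w)) ((\<lambda>x. l x + w) -` S)"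
  using assms(3)
proof (induction n arbitrary: f)
  case (Suc n)
  let ?j = "\<lambda>x. l x + w"
  have open_T: "open (?j -` S)"
    using \<open>open S\<close> l
    by (intro open_vimage continuous_intros linear_continuous_on)
  have j: "(?j has_derivative l) (at x)" for x
    using bounded_linear_imp_has_derivative[OF l] by (auto intro!: derivative_eq_intros)
  have d: "((\<lambda>x. f (?j x)) has_derivative (\<lambda>v. frechet_derivative f (at (?j x)) (l v))) (at x)"
    if "x \<in> ?j -` S" for x
  proof -
    have "(f has_derivative frechet_derivative f (at (?j x))) (at (?j x))"
      using Suc.prems that by (auto simp: frechet_derivative_works)
    then show ?thesis
      using has_derivative_compose[OF j] by blast
  qed
  have "times_differentiable_on n (\<lambda>x. frechet_derivative (\<lambda>x. f (?j x)) (at x) v) (?j -` S)" for v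
  proof -
    have "times_differentiable_on n (\<lambda>x. frechet_derivative f (at (?j x)) (l v)) (?j -` S)"
      using Suc.IH[of "\<lambda>z. frechet_derivative f (at z) (l v)"] Suc.prems by simp
    moreover have "frechet_derivative (\<lambda>x. f (?j x)) (at x) v = frechet_derivative f (at (?j x)) (l v)"
      if "x \<in> ?j -` S" for x
      using frechet_derivative_at[OF d[OF that]] by (rule fun_cong[OF sym])
    ultimately show ?thesis
      by (subst times_differentiable_on_cong[OF open_T]) auto
  qed
  then show ?case
    using d by (auto simp: differentiable_def)
qed simp

lemma times_differentiable_on_2D:
  assumes "times_differentiable_on 2 f S" "x \<in> S"
  shows "(f has_derivative frechet_derivative f (at x)) (at x)"
    and "(\<lambda>x. frechet_derivative f (at x) v) differentiable (at x)"
  using assms by (auto simp: numeral_2_eq_2 frechet_derivative_works[symmetric])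

section \<open>Derivatives as operator-valued maps\<close>

lemma fderiv_eq:
  assumes "(f has_derivative f') (at x)"
  shows "blinfun_apply (fderiv f x) = f'"
  using assms frechet_derivative_at[OF assms]
  by (simp add: fderiv_def bounded_linear_Blinfun_apply has_derivative_bounded_linear)

lemma has_derivative_fderiv:
  assumes "f differentiable (at x)"
  shows "(f has_derivative fderiv f x) (at x)"
  using assms fderiv_eq by (metis differentiable_def)

lemma has_derivative_fderiv_apply:
  assumes "A differentiable (at x)"
  shows "((\<lambda>x. blinfun_apply (A x) v) has_derivative (\<lambda>a. fderiv A x a v)) (at x)"
  using bounded_linear.has_derivative[OF blinfun.bounded_linear_left has_derivative_fderiv[OF assms]] .

lemma blinfun_basis_expansion:
  fixes A :: "'a::euclidean_space \<Rightarrow>\<^sub>L 'b::real_normed_vector"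
  shows "A = (\<Sum>i\<in>Basis. blinfun_scaleR_left (A i) o\<^sub>L blinfun_inner_left i)"
proof (rule blinfun_eqI)
  fix x
  have "A x = A (\<Sum>i\<in>Basis. (x \<bullet> i) *\<^sub>R i)"
    by (simp add: euclidean_representation)
  then show "A x = (\<Sum>i\<in>Basis. blinfun_scaleR_left (A i) o\<^sub>L blinfun_inner_left i) x"
    by (simp add: blinfun.bilinear_simps blinfun.sum_left inner_commute)
qed

text \<open>On a finite-dimensional domain an operator is a finite sum of fixed linear images of its
  values on the basis, which upgrades pointwise differentiability to differentiability in operator
  norm.\<close>

lemma differentiable_blinfun_componentwise:
  fixes A :: "'c::real_normed_vector \<Rightarrow> 'a::euclidean_space \<Rightarrow>\<^sub>L 'b::real_normed_vector"
  assumes "\<And>i. i \<in> Basis \<Longrightarrow> (\<lambda>x. A x i) differentiable (at x)"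
  shows "A differentiable (at x)"
proof -
  have "(\<lambda>x. blinfun_scaleR_left (A x i) o\<^sub>L blinfun_inner_left i) differentiable (at x)"
    if i: "i \<in> Basis" for i
  proof -
    obtain D where "((\<lambda>x. A x i) has_derivative D) (at x)"
      using assms[OF i] by (auto simp: differentiable_def)
    then have "((\<lambda>x. blinfun_scaleR_left (A x i) o\<^sub>L blinfun_inner_left i) has_derivative
        (\<lambda>h. blinfun_scaleR_left (D h) o\<^sub>L blinfun_inner_left i)) (at x)"
      by (intro bounded_linear.has_derivative[OF bounded_bilinear.bounded_linear_left[OF bounded_bilinear_blinfun_compose]]
          bounded_linear.has_derivative[OF bounded_linear_blinfun_scaleR_left])
    then show ?thesis
      by (auto simp: differentiable_def)
  qed
  then have "(\<lambda>x. \<Sum>i\<in>Basis. blinfun_scaleR_left (A x i) o\<^sub>L blinfun_inner_left i) differentiable (at x)"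
    by (intro differentiable_sum) auto
  then show ?thesis
    using blinfun_basis_expansion by (metis (no_types, lifting) ext)
qed

lemma differentiable_blinfun_apply:
  assumes "A differentiable (at x)" "w differentiable (at x)"
  shows "(\<lambda>x. blinfun_apply (A x) (w x)) differentiable (at x)"
  using assms blinfun.FDERIV unfolding differentiable_def by blast

text \<open>The second difference is an increment along \<open>a\<close> of an increment along
  \<open>b\<close>. The mean value theorem along \<open>a\<close> reduces it to a difference of
  values of \<open>f' _ a\<close> at two points, and differentiability of that map at
  \<open>x\<close> alone evaluates the difference.\<close>

lemma second_difference_limit:
  fixes f :: "'a::real_normed_vector \<Rightarrow> real"
  assumes S: "open S" "x \<in> S"
    and f': "\<And>z. z \<in> S \<Longrightarrow> (f has_derivative f' z) (at z)"
    and D: "((\<lambda>z. f' z a) has_derivative D) (at x)"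
  shows "((\<lambda>t. (f (x + t *\<^sub>R a + t *\<^sub>R b) - f (x + t *\<^sub>R a) - f (x + t *\<^sub>R b) + f x) / t\<^sup>2) \<longlongrightarrow> D b)
    (at_right 0)"
proof (rule tendstoI)
  fix e :: real assume "e > 0"
  \<comment> \<open>All displacements that occur have norm at most \<open>t * M / 2\<close>; the
    summand 1 keeps \<open>M\<close> positive when \<open>a\<close> and \<open>b\<close>
    vanish.\<close>
  define M where "M = 2 * (norm a + norm b) + 1"
  have "M > 0" by (simp add: M_def add_nonneg_pos)
  \<comment> \<open>Two linearization errors of size \<open>e' * (t * M / 2)\<close> will add up to
    \<open>e * t / 2\<close>, which is strictly below the required \<open>e * t\<close>.\<close>
  define e' where "e' = e / (2 * M)"
  have "e' > 0" using \<open>e > 0\<close> \<open>M > 0\<close> by (simp add: e'_def)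
  have lin: "linear D" using D by (rule has_derivative_linear)
  obtain d where "d > 0" and d: "\<And>z. norm (z - x) < d \<Longrightarrow>
      norm (f' z a - f' x a - D (z - x)) \<le> e' * norm (z - x)"
    using D \<open>e' > 0\<close> unfolding has_derivative_at_alt by blast
  obtain r where "r > 0" and r: "ball x r \<subseteq> S"
    using S open_contains_ball by blast
  have in_S: "x + w \<in> S" if "norm w < r" for w
    using r that by (auto simp: subset_iff dist_norm)
  define \<delta> where "\<delta> = min d r / M"
  have "\<delta> > 0" using \<open>d > 0\<close> \<open>r > 0\<close> \<open>M > 0\<close> by (simp add: \<delta>_def)
  have main: "dist ((f (x + t *\<^sub>R a + t *\<^sub>R b) - f (x + t *\<^sub>R a) - f (x + t *\<^sub>R b) + f x) / t\<^sup>2) (D b) < e"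
    if t: "0 < t" "t < \<delta>" for t
  proof -
    have tM: "t * M < min d r" using t \<open>M > 0\<close> by (simp add: \<delta>_def field_simps)
    have close: "norm ((s * t) *\<^sub>R a + c *\<^sub>R b) < min d r \<and> norm ((s * t) *\<^sub>R a + c *\<^sub>R b) \<le> t * M / 2"
      if "0 \<le> s" "s \<le> 1" "c \<in> {0, t}" for s c
    proof -
      have "norm ((s * t) *\<^sub>R a + c *\<^sub>R b) \<le> \<bar>s * t\<bar> * norm a + \<bar>c\<bar> * norm b"
        by (metis norm_scaleR norm_triangle_ineq)
      also have "\<dots> \<le> t * norm a + t * norm b"
        using that t by (intro add_mono mult_right_mono) (auto simp: abs_mult mult_le_cancel_right1)
      also have "\<dots> \<le> t * M / 2" using t by (simp add: M_def field_simps)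
      finally have "norm ((s * t) *\<^sub>R a + c *\<^sub>R b) \<le> t * M / 2" .
      moreover have "t * M / 2 < t * M" using t \<open>M > 0\<close> by simp
      ultimately show ?thesis using tM by linarith
    qed
    \<comment> \<open>Applying the mean value theorem to the difference, not to its two terms,
      yields one \<open>s\<close> common to both points.\<close>
    define g where "g s = f (x + ((s * t) *\<^sub>R a + t *\<^sub>R b)) - f (x + ((s * t) *\<^sub>R a + 0 *\<^sub>R b))" for s
    have dg: "(g has_real_derivative t * (f' (x + ((s * t) *\<^sub>R a + t *\<^sub>R b)) a - f' (x + ((s * t) *\<^sub>R a + 0 *\<^sub>R b)) a)) (at s)"
      if s: "0 \<le> s" "s \<le> 1" for s
    proof -
      have 1: "((\<lambda>s. f (x + ((s * t) *\<^sub>R a + c *\<^sub>R b))) has_derivative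
          (\<lambda>h. f' (x + ((s * t) *\<^sub>R a + c *\<^sub>R b)) ((h * t) *\<^sub>R a))) (at s)" if "c \<in> {0, t}" for c
      proof -
        have "x + ((s * t) *\<^sub>R a + c *\<^sub>R b) \<in> S"
          using close[OF s that] by (auto intro: in_S)
        moreover have "((\<lambda>s. x + ((s * t) *\<^sub>R a + c *\<^sub>R b)) has_derivative (\<lambda>h. (h * t) *\<^sub>R a)) (at s)"
          by (auto intro!: derivative_eq_intros)
        ultimately show ?thesis
          using f' has_derivative_compose by blast
      qed
      have lin: "linear (f' (x + ((s * t) *\<^sub>R a + c *\<^sub>R b)))" if "c \<in> {0, t}" for c
        using close[OF s that] by (intro has_derivative_linear[OF f'] in_S) auto
      have "(g has_derivative (\<lambda>h. f' (x + ((s * t) *\<^sub>R a + t *\<^sub>R b)) ((h * t) *\<^sub>R a)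
          - f' (x + ((s * t) *\<^sub>R a + 0 *\<^sub>R b)) ((h * t) *\<^sub>R a))) (at s)"
        unfolding g_def by (intro has_derivative_diff 1) auto
      moreover have "(\<lambda>h. f' (x + ((s * t) *\<^sub>R a + t *\<^sub>R b)) ((h * t) *\<^sub>R a)
          - f' (x + ((s * t) *\<^sub>R a + 0 *\<^sub>R b)) ((h * t) *\<^sub>R a))
          = (*) (t * (f' (x + ((s * t) *\<^sub>R a + t *\<^sub>R b)) a - f' (x + ((s * t) *\<^sub>R a + 0 *\<^sub>R b)) a))"
        using linear_scale[OF lin, of t] linear_scale[OF lin, of 0] by (auto simp: fun_eq_iff algebra_simps)
      ultimately show ?thesis
        by (simp add: has_field_derivative_def)
    qed
    obtain s where s: "0 < s" "s < 1"
      and gs: "g 1 - g 0 = (1 - 0) * (t * (f' (x + ((s * t) *\<^sub>R a + t *\<^sub>R b)) a - f' (x + ((s * t) *\<^sub>R a + 0 *\<^sub>R b)) a))"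
      using MVT2[of 0 1 g, OF _ dg] by auto
    let ?u = "(s * t) *\<^sub>R a + t *\<^sub>R b" and ?v = "(s * t) *\<^sub>R a + 0 *\<^sub>R b"
    have u: "norm (f' (x + ?u) a - f' x a - D ?u) \<le> e' * (t * M / 2)"
      using d[of "x + ?u"] close[of s t] s \<open>e' > 0\<close>
      by (smt (verit) add_diff_cancel_left' insertCI mult_left_mono)
    have v: "norm (f' (x + ?v) a - f' x a - D ?v) \<le> e' * (t * M / 2)"
      using d[of "x + ?v"] close[of s 0] s \<open>e' > 0\<close>
      by (smt (verit) add_diff_cancel_left' insertCI mult_left_mono)
    \<comment> \<open>The components along \<open>a\<close> are the same in both displacements and
      cancel.\<close>
    have Duv: "D ?u - D ?v = t * D b"
      using linear_add[OF lin] linear_scale[OF lin] by simp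
    have "\<bar>(f' (x + ?u) a - f' (x + ?v) a) - t * D b\<bar> \<le> e' * t * M"
    proof -
      have "e' * (t * M / 2) = e' * t * M / 2"
        by simp
      then show ?thesis
        using u v Duv unfolding real_norm_def by linarith
    qed
    also have "\<dots> = e * t / 2" using \<open>M > 0\<close> by (simp add: e'_def)
    also have "\<dots> < e * t" using t \<open>e > 0\<close> by simp
    finally have lt: "\<bar>(f' (x + ?u) a - f' (x + ?v) a) - t * D b\<bar> < e * t" .
    have num: "f (x + t *\<^sub>R a + t *\<^sub>R b) - f (x + t *\<^sub>R a) - f (x + t *\<^sub>R b) + f x
        = t * (f' (x + ?u) a - f' (x + ?v) a)"
      using gs by (simp add: g_def add.assoc)
    have "(f (x + t *\<^sub>R a + t *\<^sub>R b) - f (x + t *\<^sub>R a) - f (x + t *\<^sub>R b) + f x) / t\<^sup>2 - D b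
        = ((f' (x + ?u) a - f' (x + ?v) a) - t * D b) / t"
      unfolding num using t by (simp add: field_simps power2_eq_square)
    then show ?thesis
      using lt t by (simp add: dist_real_def abs_divide divide_less_eq)
  qed
  then show "\<forall>\<^sub>F t in at_right 0. dist ((f (x + t *\<^sub>R a + t *\<^sub>R b) - f (x + t *\<^sub>R a) - f (x + t *\<^sub>R b) + f x) / t\<^sup>2) (D b) < e"
    unfolding eventually_at_right_field using \<open>\<delta> > 0\<close> by (intro exI[of _ \<delta>]) auto
qed

text \<open>The second difference is unchanged when \<open>a\<close> and \<open>b\<close> are
  exchanged, so both values are limits of one and the same quotient.\<close>

lemma second_derivative_symmetric:
  fixes f :: "'a::real_normed_vector \<Rightarrow> real"
  assumes "open S" "x \<in> S"
    and "\<And>z. z \<in> S \<Longrightarrow> (f has_derivative f' z) (at z)"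
    and "((\<lambda>z. f' z a) has_derivative Da) (at x)" "((\<lambda>z. f' z b) has_derivative Db) (at x)"
  shows "Da b = Db a"
proof (rule tendsto_unique[OF _ second_difference_limit[OF assms(1-4)]])
  show "((\<lambda>t. (f (x + t *\<^sub>R a + t *\<^sub>R b) - f (x + t *\<^sub>R a) - f (x + t *\<^sub>R b) + f x) / t\<^sup>2) \<longlongrightarrow> Db a) (at_right 0)"
    using second_difference_limit[OF assms(1-3,5), of a] by (simp add: algebra_simps)
qed simp

lemma has_derivative_cong_nhds:
  assumes "(f has_derivative D) (at x)" "\<forall>\<^sub>F y in nhds x. f y = g y"
  shows "(g has_derivative D) (at x)"
  using assms unfolding eventually_nhds by (metis has_derivative_transform_within_open)

lemma differentiable_cong_nhds:
  assumes "f differentiable (at x)" "\<forall>\<^sub>F y in nhds x. f y = g y"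
  shows "g differentiable (at x)"
  using assms has_derivative_cong_nhds unfolding differentiable_def by blast

lemma isCont_eventually_in_open:
  assumes "isCont f x" "open V" "f x \<in> V"
  shows "\<forall>\<^sub>F y in nhds x. f y \<in> V"
  using assms by (metis isCont_def tendsto_at_iff_tendsto_nhds topological_tendstoD)

lemma isCont_tendsto_nhds: "isCont f x \<Longrightarrow> (f \<longlongrightarrow> f x) (nhds x)"
  by (simp add: isCont_def tendsto_at_iff_tendsto_nhds)

lemma fderiv_differentiable:
  fixes f :: "'a::euclidean_space \<Rightarrow> 'b::real_normed_vector"
  assumes S: "open S" "x \<in> S" and f: "times_differentiable_on 2 f S"
  shows "fderiv f differentiable (at x)"
proof (rule differentiable_blinfun_componentwise)
  fix i :: 'a
  show "(\<lambda>x. fderiv f x i) differentiable (at x)"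
  proof (rule differentiable_cong_nhds[OF times_differentiable_on_2D(2)[OF f S(2), of i]])
    show "\<forall>\<^sub>F y in nhds x. frechet_derivative f (at y) i = fderiv f y i"
      using eventually_nhds_in_open[OF S]
      by eventually_elim (simp add: fderiv_eq[OF times_differentiable_on_2D(1)[OF f]])
  qed
qed

lemma fderiv_fderiv_symmetric:
  fixes f :: "'a::euclidean_space \<Rightarrow> real"
  assumes S: "open S" "x \<in> S" and f: "times_differentiable_on 2 f S"
  shows "fderiv (fderiv f) x a b = fderiv (fderiv f) x b a"
proof (rule second_derivative_symmetric[OF S, where f = f and f' = "\<lambda>z. fderiv f z" and a = b and b = a])
  note d = has_derivative_fderiv_apply[OF fderiv_differentiable[OF S f]]
  show "(f has_derivative fderiv f z) (at z)" if "z \<in> S" for z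
    using times_differentiable_on_2D(1)[OF f that] has_derivative_fderiv differentiable_def by blast
  show "((\<lambda>z. fderiv f z b) has_derivative (\<lambda>w. fderiv (fderiv f) x w b)) (at x)"
    "((\<lambda>z. fderiv f z a) has_derivative (\<lambda>w. fderiv (fderiv f) x w a)) (at x)"
    using d by auto
qed

text \<open>The nested partial derivatives that occur in the mixed cost terms are expressed by
  derivatives of \<open>P\<close> along \<open>(a, 0)\<close> and \<open>(0, v)\<close>, the form to
  which symmetry of second derivatives applies.\<close>

lemma
  fixes P :: "'a::euclidean_space \<times> 'b::euclidean_space \<Rightarrow> 'c::real_normed_vector"
  assumes S: "open S" "(q0, u0) \<in> S" and P: "times_differentiable_on 2 P S"
  shows fderiv_fst: "fderiv (\<lambda>q. P (q, u0)) q0 a = frechet_derivative P (at (q0, u0)) (a, 0)"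
    and fderiv_snd: "fderiv (\<lambda>v. P (q0, v)) u0 v = frechet_derivative P (at (q0, u0)) (0, v)"
    and fderiv_fst_snd: "fderiv (\<lambda>q. fderiv (\<lambda>v. P (q, v)) u0) q0 a v
      = frechet_derivative (\<lambda>z. frechet_derivative P (at z) (0, v)) (at (q0, u0)) (a, 0)"
    and fderiv_snd_fst: "fderiv (\<lambda>v. fderiv (\<lambda>q. P (q, v)) q0) u0 v a
      = frechet_derivative (\<lambda>z. frechet_derivative P (at z) (a, 0)) (at (q0, u0)) (0, v)"
proof -
  have pairs: "((\<lambda>q. (q, u)) has_derivative (\<lambda>a. (a, 0))) (at q)" "((\<lambda>v. (q, v)) has_derivative (\<lambda>v. (0, v))) (at u)"
    for q :: 'a and u :: 'b
    by (auto intro!: derivative_eq_intros)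
  have fst: "fderiv (\<lambda>q. P (q, u)) q a = frechet_derivative P (at (q, u)) (a, 0)" if "(q, u) \<in> S" for q u a
    using fderiv_eq[OF has_derivative_compose[OF pairs(1) times_differentiable_on_2D(1)[OF P that]]] by metis
  have snd: "fderiv (\<lambda>v. P (q, v)) u v = frechet_derivative P (at (q, u)) (0, v)" if "(q, u) \<in> S" for q u v
    using fderiv_eq[OF has_derivative_compose[OF pairs(2) times_differentiable_on_2D(1)[OF P that]]] by metis
  show "fderiv (\<lambda>q. P (q, u0)) q0 a = frechet_derivative P (at (q0, u0)) (a, 0)"
    "fderiv (\<lambda>v. P (q0, v)) u0 v = frechet_derivative P (at (q0, u0)) (0, v)"
    using fst snd S by auto
  have second: "((\<lambda>z. frechet_derivative P (at z) w) has_derivative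
      frechet_derivative (\<lambda>z. frechet_derivative P (at z) w) (at (q0, u0))) (at (q0, u0))" for w
    using times_differentiable_on_2D(2)[OF P S(2)] by (simp add: frechet_derivative_works)
  have ev1: "\<forall>\<^sub>F q in nhds q0. (q, u0) \<in> S"
  proof -
    have "isCont (\<lambda>q. (q, u0)) q0"
      by (intro continuous_intros)
    from isCont_eventually_in_open[OF this S] show ?thesis .
  qed
  have ev2: "\<forall>\<^sub>F v in nhds u0. (q0, v) \<in> S"
  proof -
    have "isCont (\<lambda>v. (q0, v)) u0"
      by (intro continuous_intros)
    from isCont_eventually_in_open[OF this S] show ?thesis .
  qed
  have 1: "((\<lambda>q. fderiv (\<lambda>v. P (q, v)) u0 v) has_derivative
      (\<lambda>a. frechet_derivative (\<lambda>z. frechet_derivative P (at z) (0, v)) (at (q0, u0)) (a, 0))) (at q0)" for v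
    by (rule has_derivative_cong_nhds[OF has_derivative_compose[OF pairs(1) second]])
      (use ev1 in eventually_elim, simp add: snd)
  have 2: "((\<lambda>v. fderiv (\<lambda>q. P (q, v)) q0 a) has_derivative
      (\<lambda>v. frechet_derivative (\<lambda>z. frechet_derivative P (at z) (a, 0)) (at (q0, u0)) (0, v))) (at u0)" for a
    by (rule has_derivative_cong_nhds[OF has_derivative_compose[OF pairs(2) second]])
      (use ev2 in eventually_elim, simp add: fst)
  \<comment> \<open>So far only the entries for fixed \<open>v\<close> have been differentiated; the
    outer \<open>fderiv\<close> is meaningful once the operator-valued map itself is
    differentiable.\<close>
  have "(\<lambda>q. fderiv (\<lambda>v. P (q, v)) u0) differentiable (at q0)"
    using 1 by (intro differentiable_blinfun_componentwise) (auto simp: differentiable_def)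
  from has_derivative_unique[OF has_derivative_fderiv_apply[OF this, of v] 1]
  show "fderiv (\<lambda>q. fderiv (\<lambda>v. P (q, v)) u0) q0 a v
      = frechet_derivative (\<lambda>z. frechet_derivative P (at z) (0, v)) (at (q0, u0)) (a, 0)"
    by (rule fun_cong)
  have "(\<lambda>v. fderiv (\<lambda>q. P (q, v)) q0) differentiable (at u0)"
    using 2 by (intro differentiable_blinfun_componentwise) (auto simp: differentiable_def)
  from has_derivative_unique[OF has_derivative_fderiv_apply[OF this, of a] 2]
  show "fderiv (\<lambda>v. fderiv (\<lambda>q. P (q, v)) q0) u0 v a
      = frechet_derivative (\<lambda>z. frechet_derivative P (at z) (a, 0)) (at (q0, u0)) (0, v)"
    by (rule fun_cong)
qed

lemma fderiv_mixed_symmetric: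
  fixes P :: "'a::euclidean_space \<times> 'b::euclidean_space \<Rightarrow> real"
  assumes S: "open S" "(q, u) \<in> S" and P: "times_differentiable_on 2 P S"
  shows "fderiv (\<lambda>q. fderiv (\<lambda>v. P (q, v)) u) q a v = fderiv (\<lambda>v. fderiv (\<lambda>q. P (q, v)) q) u v a"
  unfolding fderiv_fst_snd[OF assms] fderiv_snd_fst[OF assms]
  by (rule second_derivative_symmetric[OF S times_differentiable_on_2D(1)[OF P]])
    (use times_differentiable_on_2D(2)[OF P S(2)] in \<open>simp_all add: frechet_derivative_works\<close>)

section \<open>Charts\<close>

lemma
  assumes "is_chart c"
  shows open_chart_dom: "open (fst c)"
    and open_chart_image: "open (snd c ` fst c)"
    and chart_inv_chart: "p \<in> fst c \<Longrightarrow> chart_inv c (snd c p) = p"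
    and chart_chart_inv: "q \<in> snd c ` fst c \<Longrightarrow> snd c (chart_inv c q) = q"
    and chart_inv_in: "q \<in> snd c ` fst c \<Longrightarrow> chart_inv c q \<in> fst c"
    and continuous_on_chart: "continuous_on (fst c) (snd c)"
    and continuous_on_chart_inv: "continuous_on (snd c ` fst c) (chart_inv c)"
  using assms unfolding is_chart_def homeomorphism_def by auto

lemma isCont_chart: "is_chart c \<Longrightarrow> p \<in> fst c \<Longrightarrow> isCont (snd c) p"
  using continuous_on_chart open_chart_dom continuous_on_eq_continuous_at by blast

lemma isCont_chart_inv: "is_chart c \<Longrightarrow> q \<in> snd c ` fst c \<Longrightarrow> isCont (chart_inv c) q"
  using continuous_on_chart_inv open_chart_image continuous_on_eq_continuous_at by blast

lemma is_chart_std: "is_chart (UNIV, id)"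
  by (auto simp: is_chart_def homeomorphism_def chart_inv_def inv_f_f)

lemma chart_inv_std: "chart_inv (UNIV, id) = id"
  by (auto simp: chart_inv_def)

lemma chart_inv_prod:
  assumes "is_chart c" "is_chart d" "a \<in> snd c ` fst c" "b \<in> snd d ` fst d"
  shows "chart_inv (fst c \<times> fst d, map_prod (snd c) (snd d)) (a, b) = (chart_inv c a, chart_inv d b)"
proof -
  have "inj_on (map_prod (snd c) (snd d)) (fst c \<times> fst d)"
    using chart_inv_chart[OF assms(1)] chart_inv_chart[OF assms(2)]
    by (intro map_prod_inj_on inj_onI) metis+
  then show ?thesis
    using chart_inv_in[OF assms(1,3)] chart_inv_in[OF assms(2,4)]
      chart_chart_inv[OF assms(1,3)] chart_chart_inv[OF assms(2,4)]
    unfolding chart_inv_def[of "(_, _)"] by (intro inv_into_f_eq) auto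
qed

lemma is_chart_prod:
  assumes c: "is_chart c" and d: "is_chart d"
  shows "is_chart (fst c \<times> fst d, map_prod (snd c) (snd d))"
proof -
  let ?e = "(fst c \<times> fst d, map_prod (snd c) (snd d))"
  have img: "map_prod (snd c) (snd d) ` (fst c \<times> fst d) = (snd c ` fst c) \<times> (snd d ` fst d)"
    by (rule map_prod_surj_on) auto
  have inv: "chart_inv ?e z = (chart_inv c (fst z), chart_inv d (snd z))"
    if "z \<in> (snd c ` fst c) \<times> (snd d ` fst d)" for z
    using chart_inv_prod[OF c d] that by (cases z) auto
  have "homeomorphism (fst c \<times> fst d) ((snd c ` fst c) \<times> (snd d ` fst d)) (map_prod (snd c) (snd d)) (chart_inv ?e)"
  proof (rule homeomorphismI)
    have "map_prod (snd c) (snd d) = (\<lambda>z. (snd c (fst z), snd d (snd z)))"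
      by auto
    moreover have "continuous_on (fst c \<times> fst d) (\<lambda>z. (snd c (fst z), snd d (snd z)))"
      by (intro continuous_intros continuous_on_compose2[OF continuous_on_chart[OF c]]
          continuous_on_compose2[OF continuous_on_chart[OF d]]) auto
    ultimately show "continuous_on (fst c \<times> fst d) (map_prod (snd c) (snd d))"
      by simp
    have "continuous_on ((snd c ` fst c) \<times> (snd d ` fst d)) (\<lambda>z. (chart_inv c (fst z), chart_inv d (snd z)))"
      by (intro continuous_intros continuous_on_compose2[OF continuous_on_chart_inv[OF c]]
          continuous_on_compose2[OF continuous_on_chart_inv[OF d]]) auto
    then show "continuous_on ((snd c ` fst c) \<times> (snd d ` fst d)) (chart_inv ?e)"
      by (subst continuous_on_cong[OF refl inv])
  qed (use inv c d in \<open>auto simp: chart_inv_chart chart_chart_inv chart_inv_in\<close>)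
  then show ?thesis
    using c d by (simp add: is_chart_def img open_Times)
qed

text \<open>In coordinates the overlap is the preimage of an open set under a continuous map on an
  open set. Its openness lets derivatives be computed from locally equal maps.\<close>

lemma
  assumes f: "times_differentiable_map n A B f" and "c \<in> A" "d \<in> B" and c: "is_chart c" and d: "is_chart d"
  shows open_chart_overlap: "open {q \<in> snd c ` fst c. f (chart_inv c q) \<in> fst d}" (is "open ?S")
    and times_differentiable_on_charts:
      "times_differentiable_on n (\<lambda>q. snd d (f (chart_inv c q))) {q \<in> snd c ` fst c. f (chart_inv c q) \<in> fst d}"
proof -
  have cont: "continuous_on UNIV f"
    using f by (simp add: times_differentiable_map_def)
  have "continuous_on (snd c ` fst c) (\<lambda>q. f (chart_inv c q))"
    by (rule continuous_on_compose2[OF cont continuous_on_chart_inv[OF c]]) simp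
  then have "open (snd c ` fst c \<inter> (\<lambda>q. f (chart_inv c q)) -` fst d)"
    using open_chart_image[OF c] open_chart_dom[OF d] by (rule continuous_open_preimage)
  then show "open ?S"
    by (simp add: vimage_def Int_def)
  have "snd c ` (fst c \<inter> f -` fst d) = ?S"
    using c by (force simp: chart_inv_chart)
  moreover have "times_differentiable_on n (snd d \<circ> f \<circ> chart_inv c) (snd c ` (fst c \<inter> f -` fst d))"
    using assms(1-3) unfolding times_differentiable_map_def by blast
  ultimately show "times_differentiable_on n (\<lambda>q. snd d (f (chart_inv c q))) ?S"
    by (simp add: comp_def)
qed

lemma
  assumes f: "times_differentiable_map n (prod_atlas A B) C f"
    and mem: "c \<in> A" "d \<in> B" "r \<in> C" and c: "is_chart c" and d: "is_chart d" and r: "is_chart r"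
  defines "S \<equiv> {z. fst z \<in> snd c ` fst c \<and> snd z \<in> snd d ` fst d \<and>
      f (chart_inv c (fst z), chart_inv d (snd z)) \<in> fst r}"
  shows open_prod_chart_overlap: "open S"
    and times_differentiable_on_prod_charts:
      "times_differentiable_on n (\<lambda>z. snd r (f (chart_inv c (fst z), chart_inv d (snd z)))) S"
proof -
  let ?e = "(fst c \<times> fst d, map_prod (snd c) (snd d))"
  have e: "?e \<in> prod_atlas A B"
    unfolding prod_atlas_def using mem by blast
  have inv: "chart_inv ?e z = (chart_inv c (fst z), chart_inv d (snd z))"
    if "z \<in> (snd c ` fst c) \<times> (snd d ` fst d)" for z
    using chart_inv_prod[OF c d] that by (cases z) auto
  have img: "snd ?e ` fst ?e = (snd c ` fst c) \<times> (snd d ` fst d)"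
    using map_prod_surj_on[of "snd c" "fst c" _ "snd d" "fst d"] by auto
  have S: "{q \<in> snd ?e ` fst ?e. f (chart_inv ?e q) \<in> fst r} = S"
    unfolding img S_def using inv by auto
  note e' = f e mem(3) is_chart_prod[OF c d] r
  show "open S"
    using open_chart_overlap[OF e'] S by simp
  have "times_differentiable_on n (\<lambda>q. snd r (f (chart_inv ?e q))) S"
    using times_differentiable_on_charts[OF e'] S by simp
  then show "times_differentiable_on n (\<lambda>z. snd r (f (chart_inv c (fst z), chart_inv d (snd z)))) S"
    by (rule times_differentiable_on_cong[OF \<open>open S\<close>, THEN iffD1, rotated])
      (use inv in \<open>auto simp: S_def mem_Times_iff\<close>)
qed

section \<open>Maps into a Lie group\<close>

context lie_group
begin

lemma assoc_UNIV: "a \<otimes> b \<otimes> c = a \<otimes> (b \<otimes> c)"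
  by (simp add: m_assoc carrier_UNIV)

lemma group_UNIV [simp]:
  "\<one> \<otimes> a = a" "a \<otimes> \<one> = a" "inv a \<otimes> a = \<one>" "a \<otimes> inv a = \<one>"
  "inv a \<otimes> (a \<otimes> b) = b" "a \<otimes> (inv a \<otimes> b) = b"
  by (simp_all add: carrier_UNIV flip: assoc_UNIV)

lemma chart_in_atlas: "c \<in> atlas G \<Longrightarrow> is_chart c"
  using smooth_atlas by (simp add: smooth_atlas_def)

lemma chart_at: "chart_at G p \<in> atlas G" "p \<in> fst (chart_at G p)"
proof -
  have "p \<in> (\<Union>c\<in>atlas G. fst c)"
    using smooth_atlas by (simp add: smooth_atlas_def)
  then have "\<exists>c. c \<in> atlas G \<and> p \<in> fst c"
    by blast
  then have "chart_at G p \<in> atlas G \<and> p \<in> fst (chart_at G p)"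
    unfolding chart_at_def by (rule someI_ex)
  then show "chart_at G p \<in> atlas G" "p \<in> fst (chart_at G p)" by auto
qed

lemma isCont_mult:
  assumes "isCont \<phi> n" "isCont \<psi> n"
  shows "isCont (\<lambda>s. \<phi> s \<otimes> \<psi> s) n"
proof -
  have "continuous_on UNIV (\<lambda>(g, h). g \<otimes> h)"
    using smooth_mult by (simp add: smooth_map_def times_differentiable_map_def)
  then have "isCont (\<lambda>(g, h). g \<otimes> h) (\<phi> n, \<psi> n)"
    by (simp add: continuous_on_eq_continuous_at)
  from continuous_at_compose[OF continuous_Pair[OF assms], unfolded comp_def, OF this]
  show ?thesis by simp
qed

lemma isCont_inv:
  assumes "isCont \<phi> n"
  shows "isCont (\<lambda>s. inv \<phi> s) n"
proof -
  have "continuous_on UNIV (\<lambda>g. inv g)"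
    using smooth_inv by (simp add: smooth_map_def times_differentiable_map_def)
  then have "isCont (\<lambda>g. inv g) (\<phi> n)"
    by (simp add: continuous_on_eq_continuous_at)
  from continuous_at_compose[OF assms, unfolded comp_def, OF this]
  show ?thesis by simp
qed

text \<open>Differentiability at a single point without reference to tangent spaces. Continuity is
  included because coordinate maps are arbitrary off their domains, so a condition on coordinates
  alone would not keep \<phi> inside the chart.\<close>

definition group_differentiable :: "('n::real_normed_vector \<Rightarrow> 'g) \<Rightarrow> 'n \<Rightarrow> bool"
  where "group_differentiable \<phi> n \<longleftrightarrow> isCont \<phi> n \<and>
    (\<forall>c\<in>atlas G. \<phi> n \<in> fst c \<longrightarrow> (\<lambda>s. snd c (\<phi> s)) differentiable (at n))"

lemma group_differentiable_coord: "group_differentiable \<phi> n \<Longrightarrow> c \<in> atlas G \<Longrightarrow> \<phi> n \<in> fst c \<Longrightarrow> (\<lambda>s. snd c (\<phi> s)) differentiable (at n)"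
  by (simp add: group_differentiable_def)

lemma group_differentiable_isCont: "group_differentiable \<phi> n \<Longrightarrow> isCont \<phi> n"
  by (simp add: group_differentiable_def)

lemma transition_differentiable:
  assumes "c \<in> atlas G" "d \<in> atlas G" "p \<in> fst c" "p \<in> fst d"
  shows "(snd d \<circ> chart_inv c) differentiable (at (snd c p))"
proof -
  have "smooth_on (snd d \<circ> chart_inv c) (snd c ` (fst c \<inter> fst d))"
    using smooth_atlas assms by (auto simp: smooth_atlas_def)
  then have "times_differentiable_on (Suc 0) (snd d \<circ> chart_inv c) (snd c ` (fst c \<inter> fst d))"
    unfolding smooth_on_def by blast
  then show ?thesis
    using assms by auto
qed

text \<open>One chart is enough: near \<open>n\<close> continuity keeps \<phi> inside it, and every
  other coordinate expression arises by applying a differentiable transition map.\<close>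

lemma group_differentiableI:
  assumes "isCont \<phi> n" "c \<in> atlas G" "\<phi> n \<in> fst c" "(\<lambda>s. snd c (\<phi> s)) differentiable (at n)"
  shows "group_differentiable \<phi> n"
  unfolding group_differentiable_def
proof (intro conjI ballI impI)
  fix d assume d: "d \<in> atlas G" "\<phi> n \<in> fst d"
  have "((snd d \<circ> chart_inv c) \<circ> (\<lambda>s. snd c (\<phi> s))) differentiable (at n)"
    by (intro differentiable_chain_at assms transition_differentiable d)
  then show "(\<lambda>s. snd d (\<phi> s)) differentiable (at n)"
    by (rule differentiable_cong_nhds)
      (use isCont_eventually_in_open[OF assms(1) open_chart_dom assms(3)] in
        \<open>auto elim!: eventually_mono simp: chart_inv_chart chart_in_atlas assms(2)\<close>)
qed (fact assms(1))

lemma group_differentiable_const: "group_differentiable (\<lambda>_. p) n"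
  by (auto simp: group_differentiable_def)

lemma group_differentiable_chart_inv:
  assumes "c \<in> atlas G" "q \<in> snd c ` fst c"
  shows "group_differentiable (chart_inv c) q"
proof (rule group_differentiableI[OF isCont_chart_inv[OF chart_in_atlas[OF assms(1)] assms(2)] assms(1)])
  note c = chart_in_atlas[OF assms(1)]
  show "chart_inv c q \<in> fst c"
    using chart_inv_in[OF c assms(2)] .
  have "\<forall>\<^sub>F s in nhds q. s \<in> snd c ` fst c"
    using open_chart_image[OF c] assms(2) by (rule eventually_nhds_in_open)
  then show "(\<lambda>s. snd c (chart_inv c s)) differentiable (at q)"
    by (intro differentiable_cong_nhds[OF differentiable_ident])
      (auto elim!: eventually_mono simp: chart_chart_inv[OF c])
qed

lemma group_differentiable_compose:
  assumes "group_differentiable \<phi> (k n)" "k differentiable (at n)"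
  shows "group_differentiable (\<lambda>s. \<phi> (k s)) n"
  using assms continuous_at_compose[OF differentiable_imp_continuous_within[OF assms(2)], of \<phi>]
    differentiable_chain_at[OF assms(2)]
  unfolding group_differentiable_def comp_def by auto

lemma mult_charts:
  assumes "c \<in> atlas G" "d \<in> atlas G" "r \<in> atlas G"
  defines "S \<equiv> {z. fst z \<in> snd c ` fst c \<and> snd z \<in> snd d ` fst d \<and>
      chart_inv c (fst z) \<otimes> chart_inv d (snd z) \<in> fst r}"
  shows "open S"
    and "times_differentiable_on n (\<lambda>z. snd r (chart_inv c (fst z) \<otimes> chart_inv d (snd z))) S"
proof -
  have m: "times_differentiable_map n (prod_atlas (atlas G) (atlas G)) (atlas G) (\<lambda>(g, h). g \<otimes> h)"
    using smooth_mult by (simp add: smooth_map_def)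
  note * = m assms(1-3) chart_in_atlas[OF assms(1)] chart_in_atlas[OF assms(2)] chart_in_atlas[OF assms(3)]
  show "open S"
    using open_prod_chart_overlap[OF *] by (simp add: S_def)
  show "times_differentiable_on n (\<lambda>z. snd r (chart_inv c (fst z) \<otimes> chart_inv d (snd z))) S"
    using times_differentiable_on_prod_charts[OF *] by (simp add: S_def)
qed

lemma group_differentiable_mult:
  assumes \<phi>: "group_differentiable \<phi> n" and \<psi>: "group_differentiable \<psi> n"
  shows "group_differentiable (\<lambda>s. \<phi> s \<otimes> \<psi> s) n"
proof (rule group_differentiableI[OF isCont_mult chart_at])
  let ?c = "chart_at G (\<phi> n)" and ?d = "chart_at G (\<psi> n)" and ?r = "chart_at G (\<phi> n \<otimes> \<psi> n)"
  let ?N = "\<lambda>z. snd ?r (chart_inv ?c (fst z) \<otimes> chart_inv ?d (snd z))"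
  let ?k = "\<lambda>s. (snd ?c (\<phi> s), snd ?d (\<psi> s))"
  have "?N differentiable (at (?k n))"
    using mult_charts(2)[OF chart_at(1)[of "\<phi> n"] chart_at(1)[of "\<psi> n"] chart_at(1)[of "\<phi> n \<otimes> \<psi> n"], of "Suc 0"]
    by (auto simp: chart_at chart_inv_chart[OF chart_in_atlas])
  moreover have "?k differentiable (at n)"
  proof -
    obtain D1 D2 where "((\<lambda>s. snd ?c (\<phi> s)) has_derivative D1) (at n)" "((\<lambda>s. snd ?d (\<psi> s)) has_derivative D2) (at n)"
      using group_differentiable_coord[OF \<phi> chart_at] group_differentiable_coord[OF \<psi> chart_at] by (auto simp: differentiable_def)
    then show ?thesis
      by (auto simp: differentiable_def intro!: has_derivative_Pair)
  qed
  ultimately have "(?N \<circ> ?k) differentiable (at n)"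
    by (rule differentiable_chain_at[rotated])
  moreover have "\<forall>\<^sub>F s in nhds n. \<phi> s \<in> fst ?c" "\<forall>\<^sub>F s in nhds n. \<psi> s \<in> fst ?d"
    by (auto intro!: isCont_eventually_in_open group_differentiable_isCont \<phi> \<psi> open_chart_dom chart_in_atlas chart_at)
  then have "\<forall>\<^sub>F s in nhds n. (?N \<circ> ?k) s = snd ?r (\<phi> s \<otimes> \<psi> s)"
    by eventually_elim (simp add: chart_inv_chart[OF chart_in_atlas] chart_at)
  ultimately show "(\<lambda>s. snd ?r (\<phi> s \<otimes> \<psi> s)) differentiable (at n)"
    by (rule differentiable_cong_nhds)
qed (use \<phi> \<psi> in \<open>auto simp: group_differentiable_def\<close>)

lemma group_differentiable_inv:
  assumes \<phi>: "group_differentiable \<phi> n"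
  shows "group_differentiable (\<lambda>s. inv \<phi> s) n"
proof (rule group_differentiableI[OF isCont_inv chart_at])
  let ?c = "chart_at G (\<phi> n)" and ?r = "chart_at G (inv \<phi> n)"
  let ?N = "\<lambda>z. snd ?r (inv (chart_inv ?c z))"
  let ?k = "\<lambda>s. snd ?c (\<phi> s)"
  have "times_differentiable_map (Suc 0) (atlas G) (atlas G) (\<lambda>g. inv g)"
    using smooth_inv unfolding smooth_map_def by blast
  from times_differentiable_on_charts[OF this chart_at(1)[of "\<phi> n"] chart_at(1)[of "inv \<phi> n"]
      chart_in_atlas[OF chart_at(1)] chart_in_atlas[OF chart_at(1)]]
  have "?N differentiable (at (?k n))"
    by (auto simp: chart_at chart_inv_chart[OF chart_in_atlas])
  moreover have "?k differentiable (at n)"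
    by (rule group_differentiable_coord[OF \<phi> chart_at])
  ultimately have "(?N \<circ> ?k) differentiable (at n)"
    by (rule differentiable_chain_at[rotated])
  moreover have "\<forall>\<^sub>F s in nhds n. \<phi> s \<in> fst ?c"
    by (auto intro!: isCont_eventually_in_open group_differentiable_isCont \<phi> open_chart_dom chart_in_atlas chart_at)
  then have "\<forall>\<^sub>F s in nhds n. (?N \<circ> ?k) s = snd ?r (inv \<phi> s)"
    by eventually_elim (simp add: chart_inv_chart[OF chart_in_atlas] chart_at)
  ultimately show "(\<lambda>s. snd ?r (inv \<phi> s)) differentiable (at n)"
    by (rule differentiable_cong_nhds)
qed (use \<phi> in \<open>auto simp: group_differentiable_def\<close>)

end

section \<open>Left translation and the exponential map\<close>

context lie_group
begin

text \<open>Charts are not assumed to be centred, so the coordinate of the identity may differ from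
  0.\<close>

abbreviation id_coord :: 'e ("e\<^sub>0") where "e\<^sub>0 \<equiv> coord G \<one> \<one>"

abbreviation from_id_coord :: "'e \<Rightarrow> 'g" ("\<psi>\<^sub>0") where "\<psi>\<^sub>0 \<equiv> coord_inv G \<one>"

lemma from_id_coord:
  "\<psi>\<^sub>0 e\<^sub>0 = \<one>" "group_differentiable \<psi>\<^sub>0 e\<^sub>0" "isCont \<psi>\<^sub>0 e\<^sub>0"
  "\<forall>\<^sub>F b in nhds e\<^sub>0. coord G \<one> (\<psi>\<^sub>0 b) = b"
  "\<forall>\<^sub>F h in nhds \<one>. \<psi>\<^sub>0 (coord G \<one> h) = h"
proof -
  note c = chart_in_atlas[OF chart_at(1)[of \<one>]]
  have e0: "e\<^sub>0 \<in> snd (chart_at G \<one>) ` fst (chart_at G \<one>)"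
    using chart_at(2) by (auto simp: coord_def)
  show "\<psi>\<^sub>0 e\<^sub>0 = \<one>"
    using chart_inv_chart[OF c chart_at(2)] by (simp add: coord_def coord_inv_def)
  show 1: "group_differentiable \<psi>\<^sub>0 e\<^sub>0"
    using group_differentiable_chart_inv[OF chart_at(1) e0] by (simp add: coord_inv_def)
  show "isCont \<psi>\<^sub>0 e\<^sub>0"
    using 1 by (rule group_differentiable_isCont)
  show "\<forall>\<^sub>F b in nhds e\<^sub>0. coord G \<one> (\<psi>\<^sub>0 b) = b"
    using eventually_nhds_in_open[OF open_chart_image[OF c] e0]
    by (auto elim!: eventually_mono simp: coord_def coord_inv_def chart_chart_inv[OF c])
  show "\<forall>\<^sub>F h in nhds \<one>. \<psi>\<^sub>0 (coord G \<one> h) = h"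
    using eventually_nhds_in_open[OF open_chart_dom[OF c] chart_at(2)]
    by (auto elim!: eventually_mono simp: coord_def coord_inv_def chart_inv_chart[OF c])
qed

lemma group_differentiable_id_coord:
  assumes "group_differentiable \<phi> n" "\<phi> n = \<one>"
  shows "(\<lambda>s. coord G \<one> (\<phi> s)) differentiable (at n)"
  using group_differentiable_coord[OF assms(1) chart_at(1)] chart_at(2) assms(2) by (simp add: coord_def)

text \<open>\<open>left_trans_tangent\<close> reads its values in the chart preferred at
  \<open>h\<close>, which can jump as \<open>h\<close> moves. With the target chart \<open>c\<close>
  as a parameter the operator can be differentiated in \<open>h\<close>.\<close>

definition left_trans_in :: "('g, 'e) chart \<Rightarrow> 'g \<Rightarrow> 'e \<Rightarrow>\<^sub>L 'e"
  where "left_trans_in c h = fderiv (\<lambda>b. snd c (h \<otimes> \<psi>\<^sub>0 b)) e\<^sub>0"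

lemma left_trans_tangent_eq: "left_trans_tangent G h = left_trans_in (chart_at G h) h"
  by (simp add: left_trans_tangent_def left_trans_in_def comp_def coord_def)

lemma left_trans_in_has_derivative:
  assumes "c \<in> atlas G" "h \<in> fst c"
  shows "((\<lambda>b. snd c (h \<otimes> \<psi>\<^sub>0 b)) has_derivative left_trans_in c h) (at e\<^sub>0)"
proof -
  have "group_differentiable (\<lambda>b. h \<otimes> \<psi>\<^sub>0 b) e\<^sub>0"
    by (intro group_differentiable_mult group_differentiable_const from_id_coord)
  then have "(\<lambda>b. snd c (h \<otimes> \<psi>\<^sub>0 b)) differentiable (at e\<^sub>0)"
    by (rule group_differentiable_coord) (use assms in \<open>auto simp: from_id_coord\<close>)
  then show ?thesis
    unfolding left_trans_in_def by (rule has_derivative_fderiv)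
qed

lemma left_trans_in_id: "left_trans_in (chart_at G \<one>) \<one> x = x"
proof -
  have "((\<lambda>b. snd (chart_at G \<one>) (\<one> \<otimes> \<psi>\<^sub>0 b)) has_derivative (\<lambda>b. b)) (at e\<^sub>0)"
    by (rule has_derivative_cong_nhds[OF has_derivative_ident])
      (use from_id_coord(4) in \<open>auto elim!: eventually_mono simp: coord_def\<close>)
  from has_derivative_unique[OF this left_trans_in_has_derivative[OF chart_at]]
  show ?thesis by metis
qed

text \<open>The differentiated function does not mention \<open>c\<close>, so this formula also
  serves to compare the expressions obtained in different charts.\<close>

lemma has_derivative_along_left_trans:
  assumes c: "c \<in> atlas G" "h \<in> fst c" and f: "((\<lambda>q. f (chart_inv c q)) has_derivative D) (at (snd c h))"
  shows "((\<lambda>b. f (h \<otimes> \<psi>\<^sub>0 b)) has_derivative (\<lambda>x. D (left_trans_in c h x))) (at e\<^sub>0)"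
proof -
  have "((\<lambda>q. f (chart_inv c q)) has_derivative D) (at (snd c (h \<otimes> \<psi>\<^sub>0 e\<^sub>0)))"
    using f by (simp add: from_id_coord)
  from has_derivative_compose[OF left_trans_in_has_derivative[OF c] this]
  have 1: "((\<lambda>b. f (chart_inv c (snd c (h \<otimes> \<psi>\<^sub>0 b)))) has_derivative (\<lambda>x. D (left_trans_in c h x))) (at e\<^sub>0)" .
  have "isCont (\<lambda>b. h \<otimes> \<psi>\<^sub>0 b) e\<^sub>0"
    by (intro isCont_mult from_id_coord) simp
  then have "\<forall>\<^sub>F b in nhds e\<^sub>0. h \<otimes> \<psi>\<^sub>0 b \<in> fst c"
    by (rule isCont_eventually_in_open) (use c in \<open>simp_all add: from_id_coord open_chart_dom chart_in_atlas\<close>)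
  then show ?thesis
    by (intro has_derivative_cong_nhds[OF 1])
      (auto elim!: eventually_mono simp: chart_inv_chart chart_in_atlas c)
qed

text \<open>\<open>R\<close> is the derivative of translating back by \<open>inv h\<close>.
  Translating forth and back is the identity near \<open>e\<^sub>0\<close>, so the chain rule makes
  \<open>R\<close> a left inverse.\<close>

lemma left_trans_in_left_inverse:
  assumes c: "c \<in> atlas G" "h \<in> fst c"
  obtains R where "((\<lambda>q. coord G \<one> (inv h \<otimes> chart_inv c q)) has_derivative R) (at (snd c h))"
    and "\<And>x. R (left_trans_in c h x) = x"
proof -
  have ch: "chart_inv c (snd c h) = h"
    using chart_inv_chart[OF chart_in_atlas] c by blast
  have "(\<lambda>q. coord G \<one> (inv h \<otimes> chart_inv c q)) differentiable (at (snd c h))"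
    by (intro group_differentiable_id_coord group_differentiable_mult group_differentiable_const group_differentiable_chart_inv) (use c in \<open>auto simp: ch\<close>)
  then obtain R where R: "((\<lambda>q. coord G \<one> (inv h \<otimes> chart_inv c q)) has_derivative R) (at (snd c h))"
    by (auto simp: differentiable_def)
  have 1: "((\<lambda>b. coord G \<one> (inv h \<otimes> (h \<otimes> \<psi>\<^sub>0 b))) has_derivative (\<lambda>x. R (left_trans_in c h x))) (at e\<^sub>0)"
    using has_derivative_along_left_trans[OF c R] .
  have "((\<lambda>b. coord G \<one> (inv h \<otimes> (h \<otimes> \<psi>\<^sub>0 b))) has_derivative (\<lambda>b. b)) (at e\<^sub>0)"
    by (rule has_derivative_cong_nhds[OF has_derivative_ident])
      (use from_id_coord(4) in \<open>auto elim!: eventually_mono\<close>)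
  from has_derivative_unique[OF 1 this] show ?thesis
    using R that by metis
qed

section \<open>Uniqueness of the curves that define the exponential map\<close>

lemma exp_curve_translated:
  assumes "exp_curve G x \<gamma>"
  shows "group_differentiable \<gamma> t"
    and "((\<lambda>s. coord G \<one> (inv (\<gamma> t) \<otimes> \<gamma> s)) has_derivative (\<lambda>h. h *\<^sub>R x)) (at t)"
proof -
  let ?c = "chart_at G (\<gamma> t)"
  have d: "((\<lambda>s. snd ?c (\<gamma> s)) has_derivative (\<lambda>h. h *\<^sub>R left_trans_in ?c (\<gamma> t) x)) (at t)"
    using assms by (simp add: exp_curve_def has_vector_derivative_def left_trans_tangent_eq comp_def coord_def)
  have cont: "isCont \<gamma> t"
    using assms by (simp add: exp_curve_def continuous_on_eq_continuous_at)
  show "group_differentiable \<gamma> t"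
    using d by (intro group_differentiableI[OF cont chart_at]) (auto simp: differentiable_def)
  \<comment> \<open>\<open>R\<close> carries velocities at \<open>\<gamma> t\<close> back to the
    identity, where the moving vector of the curve equation becomes the constant
    \<open>x\<close>.\<close>
  obtain R where R: "((\<lambda>q. coord G \<one> (inv (\<gamma> t) \<otimes> chart_inv ?c q)) has_derivative R) (at (snd ?c (\<gamma> t)))"
    and left_inv: "\<And>x. R (left_trans_in ?c (\<gamma> t) x) = x"
    using left_trans_in_left_inverse[OF chart_at] by blast
  have "((\<lambda>s. coord G \<one> (inv (\<gamma> t) \<otimes> chart_inv ?c (snd ?c (\<gamma> s)))) has_derivative (\<lambda>h. h *\<^sub>R x)) (at t)"
    using has_derivative_compose[OF d R] left_inv linear_scale[OF has_derivative_linear[OF R]] by simp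
  then show "((\<lambda>s. coord G \<one> (inv (\<gamma> t) \<otimes> \<gamma> s)) has_derivative (\<lambda>h. h *\<^sub>R x)) (at t)"
    by (rule has_derivative_cong_nhds)
      (use isCont_eventually_in_open[OF cont open_chart_dom chart_at(2)] in
        \<open>auto elim!: eventually_mono simp: chart_inv_chart chart_in_atlas chart_at(1)\<close>)
qed

text \<open>Two solutions differ by a constant: \<open>(a, b) \<mapsto> \<gamma>(t) a b\<inverse> \<eta>(t)\<inverse>\<close> is constant on the diagonal, and
  the two translated curves leave the identity with the same velocity, so \<open>\<gamma> \<eta>\<inverse>\<close> has derivative zero.\<close>

lemma exp_curve_quotient_derivative:
  assumes \<gamma>: "exp_curve G x \<gamma>" and \<eta>: "exp_curve G x \<eta>"
    and r: "r \<in> atlas G" "\<gamma> t \<otimes> inv (\<eta> t) \<in> fst r"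
  shows "((\<lambda>s. snd r (\<gamma> s \<otimes> inv (\<eta> s))) has_derivative (\<lambda>_. 0)) (at t)"
proof -
  let ?p = "\<lambda>z. \<gamma> t \<otimes> \<psi>\<^sub>0 (fst z) \<otimes> inv (\<eta> t \<otimes> \<psi>\<^sub>0 (snd z))"
  have "group_differentiable (\<lambda>z. \<psi>\<^sub>0 (fst z)) (e\<^sub>0, e\<^sub>0)"
    by (rule group_differentiable_compose) (simp_all add: from_id_coord(2) bounded_linear_imp_differentiable bounded_linear_fst)
  moreover have "group_differentiable (\<lambda>z. \<psi>\<^sub>0 (snd z)) (e\<^sub>0, e\<^sub>0)"
    by (rule group_differentiable_compose) (simp_all add: from_id_coord(2) bounded_linear_imp_differentiable bounded_linear_snd)
  ultimately have "group_differentiable ?p (e\<^sub>0, e\<^sub>0)"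
    by (intro group_differentiable_mult group_differentiable_inv group_differentiable_const)
  then have "(\<lambda>z. snd r (?p z)) differentiable (at (e\<^sub>0, e\<^sub>0))"
    by (rule group_differentiable_coord) (use r in \<open>simp_all add: from_id_coord\<close>)
  then obtain D where D: "((\<lambda>z. snd r (?p z)) has_derivative D) (at (e\<^sub>0, e\<^sub>0))"
    by (auto simp: differentiable_def)
  \<comment> \<open>Used twice: along straight lines, to evaluate \<open>D\<close> on the diagonal,
    and along the two translated curves.\<close>
  have along: "((\<lambda>s. snd r (?p (a s, b s))) has_derivative (\<lambda>h. D (h *\<^sub>R x, h *\<^sub>R x))) (at t0)"
    if "(a has_derivative (\<lambda>h. h *\<^sub>R x)) (at t0)" "(b has_derivative (\<lambda>h. h *\<^sub>R x)) (at t0)"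
      "a t0 = e\<^sub>0" "b t0 = e\<^sub>0" for a b and t0 :: real
    using has_derivative_compose[OF has_derivative_Pair[OF that(1,2)], of "\<lambda>z. snd r (?p z)" D] D that(3,4)
    by simp
  have "((\<lambda>s. snd r (?p (e\<^sub>0 + s *\<^sub>R x, e\<^sub>0 + s *\<^sub>R x))) has_derivative (\<lambda>h. D (h *\<^sub>R x, h *\<^sub>R x))) (at 0)"
    by (rule along) (auto intro!: derivative_eq_intros)
  moreover have "?p (a, a) = \<gamma> t \<otimes> inv (\<eta> t)" for a
  proof -
    have "inv (\<eta> t \<otimes> \<psi>\<^sub>0 a) = inv \<psi>\<^sub>0 a \<otimes> inv \<eta> t"
      by (simp add: inv_mult_group carrier_UNIV)
    then show ?thesis
      by (simp add: assoc_UNIV)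
  qed
  ultimately have "((\<lambda>s::real. snd r (\<gamma> t \<otimes> inv (\<eta> t))) has_derivative (\<lambda>h. D (h *\<^sub>R x, h *\<^sub>R x))) (at 0)"
    by simp
  from has_derivative_unique[OF this has_derivative_const]
  have zero: "D (h *\<^sub>R x, h *\<^sub>R x) = 0" for h :: real
    by metis
  let ?a = "\<lambda>s. coord G \<one> (inv (\<gamma> t) \<otimes> \<gamma> s)" and ?b = "\<lambda>s. coord G \<one> (inv (\<eta> t) \<otimes> \<eta> s)"
  have 1: "((\<lambda>s. snd r (?p (?a s, ?b s))) has_derivative (\<lambda>_. 0)) (at t)"
    using along[OF exp_curve_translated(2)[OF \<gamma>] exp_curve_translated(2)[OF \<eta>]] by (simp add: zero)
  have inv_coord: "\<forall>\<^sub>F s in nhds t. \<psi>\<^sub>0 (coord G \<one> (inv (\<beta> t) \<otimes> \<beta> s)) = inv (\<beta> t) \<otimes> \<beta> s" if "exp_curve G x \<beta>" for \<beta>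
  proof -
    have "isCont (\<lambda>s. inv (\<beta> t) \<otimes> \<beta> s) t"
      by (intro isCont_mult group_differentiable_isCont[OF exp_curve_translated(1)[OF that]]) simp
    from filterlim_iff[THEN iffD1, OF isCont_tendsto_nhds[OF this], rule_format, of "\<lambda>h. \<psi>\<^sub>0 (coord G \<one> h) = h"]
    show ?thesis
      using from_id_coord(5) by simp
  qed
  have "\<forall>\<^sub>F s in nhds t. snd r (?p (?a s, ?b s)) = snd r (\<gamma> s \<otimes> inv (\<eta> s))"
    using inv_coord[OF \<gamma>] inv_coord[OF \<eta>] by eventually_elim (simp add: assoc_UNIV)
  with 1 show ?thesis
    by (rule has_derivative_cong_nhds)
qed

lemma exp_curve_unique:
  assumes \<gamma>: "exp_curve G x \<gamma>" and \<eta>: "exp_curve G x \<eta>"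
  shows "\<gamma> = \<eta>"
proof -
  let ?m = "\<lambda>s. \<gamma> s \<otimes> inv (\<eta> s)"
  have cont: "isCont ?m t" for t
    by (intro isCont_mult isCont_inv group_differentiable_isCont[OF exp_curve_translated(1)[OF \<gamma>]]
        group_differentiable_isCont[OF exp_curve_translated(1)[OF \<eta>]])
  \<comment> \<open>A vanishing derivative gives constancy only while the quotient stays in one
    chart; connectedness of the real line then makes it global.\<close>
  have locally_const: "\<exists>T. open T \<and> t \<in> T \<and> (\<forall>s\<in>T. ?m s = ?m t)" for t
  proof -
    let ?r = "chart_at G (?m t)"
    note r = chart_in_atlas[OF chart_at(1)[of "?m t"]]
    have "\<forall>\<^sub>F s in nhds t. ?m s \<in> fst ?r"
      by (rule isCont_eventually_in_open[OF cont open_chart_dom[OF r] chart_at(2)])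
    then obtain e where "e > 0" and e: "\<And>s. s \<in> ball t e \<Longrightarrow> ?m s \<in> fst ?r"
      unfolding eventually_nhds_metric by (auto simp: dist_commute)
    have "((\<lambda>s. snd ?r (?m s)) has_derivative (\<lambda>_. 0)) (at s within ball t e)" if "s \<in> ball t e" for s
      using exp_curve_quotient_derivative[OF \<gamma> \<eta> chart_at(1) e[OF that]] by (rule has_derivative_at_withinI)
    from has_derivative_zero_constant[OF convex_ball this]
    obtain k where k: "\<And>s. s \<in> ball t e \<Longrightarrow> snd ?r (?m s) = k"
      by blast
    have "?m s = chart_inv ?r k" if "s \<in> ball t e" for s
      using chart_inv_chart[OF r e[OF that]] k[OF that] by simp
    then have "\<forall>s\<in>ball t e. ?m s = ?m t"
      using \<open>e > 0\<close> by (metis centre_in_ball)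
    then show ?thesis
      using \<open>e > 0\<close> by (meson centre_in_ball open_ball)
  qed
  have "?m constant_on UNIV"
    by (rule locally_constant_imp_constant) (use locally_const in \<open>auto simp: connected_UNIV\<close>)
  then have "?m t = ?m 0" for t
    by (auto simp: constant_on_def)
  then have "?m t = \<one>" for t
    using \<gamma> \<eta> group_UNIV(4)[of \<one>] by (simp add: exp_curve_def)
  moreover have "?m t \<otimes> \<eta> t = \<gamma> t" for t
    by (simp add: assoc_UNIV)
  ultimately have "\<gamma> t = \<eta> t" for t
    by (metis group_UNIV(1))
  then show ?thesis ..
qed

lemma lie_exp_eq:
  assumes "exp_curve G x \<gamma>"
  shows "lie_exp G x = \<gamma> 1"
proof -
  have "(THE c. exp_curve G x c) = \<gamma>"
    using assms exp_curve_unique by blast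
  then show ?thesis by (simp add: lie_exp_def)
qed

text \<open>At time 1 this gives \<open>lie_exp G (r *\<^sub>R x) = \<gamma> r\<close>, so the whole
  curve consists of values of the exponential map.\<close>

lemma exp_curve_scale:
  assumes "exp_curve G x \<gamma>"
  shows "exp_curve G (r *\<^sub>R x) (\<lambda>t. \<gamma> (r * t))"
  unfolding exp_curve_def
proof (intro conjI allI)
  show "\<gamma> (r * 0) = \<one>"
    using assms by (simp add: exp_curve_def)
  have "continuous_on UNIV \<gamma>"
    using assms by (simp add: exp_curve_def)
  moreover have "continuous_on UNIV (\<lambda>t. r * t)"
    by (intro continuous_intros)
  ultimately show "continuous_on UNIV (\<lambda>t. \<gamma> (r * t))"
    by (rule continuous_on_compose2) simp
  fix t
  have 1: "((coord G (\<gamma> (r * t)) \<circ> \<gamma>) has_derivative (\<lambda>h. h *\<^sub>R left_trans_tangent G (\<gamma> (r * t)) x)) (at (r * t))"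
    using assms by (simp add: exp_curve_def has_vector_derivative_def)
  have 2: "((\<lambda>t. r * t) has_derivative (\<lambda>h. r * h)) (at t)"
    by (auto intro!: derivative_eq_intros)
  show "((coord G (\<gamma> (r * t)) \<circ> (\<lambda>t. \<gamma> (r * t))) has_vector_derivative left_trans_tangent G (\<gamma> (r * t)) (r *\<^sub>R x)) (at t)"
    using has_derivative_compose[OF 2 1]
    by (simp add: has_vector_derivative_def comp_def blinfun.scaleR_right mult.commute)
qed

lemma exp_curve_zero: "exp_curve G 0 (\<lambda>_. \<one>)"
  by (simp add: exp_curve_def has_vector_derivative_def comp_def)

lemma lie_exp_zero: "lie_exp G 0 = \<one>"
  by (simp add: lie_exp_eq[OF exp_curve_zero])

text \<open>If no curve existed for some \<open>x \<noteq> 0\<close>, none would exist for \<open>x/2\<close>, and both points would be sent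
  by \<^const>\<open>lie_exp\<close> to the same junk value, although it is injective near \<open>0\<close>.\<close>

lemma exp_curve_exists:
  assumes "inj_on (lie_exp G) (ball 0 r)" "norm x < r"
  shows "\<exists>\<gamma>. exp_curve G x \<gamma>"
proof (rule ccontr)
  assume none: "\<nexists>\<gamma>. exp_curve G x \<gamma>"
  have "\<nexists>\<gamma>. exp_curve G ((1/2) *\<^sub>R x) \<gamma>"
    using none exp_curve_scale[of "(1/2) *\<^sub>R x" _ 2] by auto
  with none have "exp_curve G x = exp_curve G ((1/2) *\<^sub>R x)"
    by auto
  then have "lie_exp G x = lie_exp G ((1/2) *\<^sub>R x)"
    by (simp add: lie_exp_def)
  moreover have "x \<in> ball 0 r" "(1/2) *\<^sub>R x \<in> ball 0 r"
    using assms(2) norm_ge_zero[of x] unfolding mem_ball_0 norm_scaleR by linarith+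
  ultimately have "x = (1/2) *\<^sub>R x"
    using assms(1) by (meson inj_onD)
  then have "norm x = norm ((1/2) *\<^sub>R x)"
    by (rule arg_cong)
  then have "x = 0"
    by simp
  then show False
    using none exp_curve_zero by blast
qed

section \<open>The derivative of the exponential map at 0\<close>

lemma left_trans_in_differentiable:
  assumes c: "c \<in> atlas G" "h \<in> fst c"
  shows "(\<lambda>q. left_trans_in c (chart_inv c q) y) differentiable (at (snd c h))"
proof -
  let ?d = "chart_at G \<one>"
  \<comment> \<open>This is multiplication in coordinates. The operator in question is its partial
    derivative in the second argument at \<open>e\<^sub>0\<close>, and second-order
    differentiability of multiplication makes that differentiable in the first argument.\<close>
  let ?\<mu> = "\<lambda>z. snd c (chart_inv c (fst z) \<otimes> chart_inv ?d (snd z))"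
  define S where "S = {z. fst z \<in> snd c ` fst c \<and> snd z \<in> snd ?d ` fst ?d \<and>
      chart_inv c (fst z) \<otimes> chart_inv ?d (snd z) \<in> fst c}"
  have S: "open S" and \<mu>: "times_differentiable_on 2 ?\<mu> S"
    using mult_charts[OF c(1) chart_at(1) c(1)] by (simp_all add: S_def)
  have mem: "(snd c h, e\<^sub>0) \<in> S"
    using c chart_at(2) from_id_coord(1) chart_inv_chart[OF chart_in_atlas[OF c(1)] c(2)]
    by (auto simp: S_def coord_def coord_inv_def)
  have eq: "left_trans_in c (chart_inv c q) y = frechet_derivative ?\<mu> (at (q, e\<^sub>0)) (0, y)"
    if "(q, e\<^sub>0) \<in> S" for q
  proof -
    have "((\<lambda>b. (q, b)) has_derivative (\<lambda>h. (0, h))) (at e\<^sub>0)"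
      by (auto intro!: derivative_eq_intros)
    from has_derivative_compose[OF this times_differentiable_on_2D(1)[OF \<mu> that]]
    have "((\<lambda>b. snd c (chart_inv c q \<otimes> \<psi>\<^sub>0 b)) has_derivative
        (\<lambda>h. frechet_derivative ?\<mu> (at (q, e\<^sub>0)) (0, h))) (at e\<^sub>0)"
      by (simp add: coord_inv_def)
    from fderiv_eq[OF this] show ?thesis
      by (simp add: left_trans_in_def)
  qed
  have pair: "(\<lambda>q. (q, e\<^sub>0)) differentiable (at (snd c h))"
    unfolding differentiable_def by (auto intro!: derivative_eq_intros)
  then have "isCont (\<lambda>q. (q, e\<^sub>0)) (snd c h)"
    by (rule differentiable_imp_continuous_within)
  from isCont_eventually_in_open[OF this S mem]
  have ev: "\<forall>\<^sub>F q in nhds (snd c h). frechet_derivative ?\<mu> (at (q, e\<^sub>0)) (0, y) = left_trans_in c (chart_inv c q) y"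
    by eventually_elim (simp add: eq)
  have "((\<lambda>z. frechet_derivative ?\<mu> (at z) (0, y)) \<circ> (\<lambda>q. (q, e\<^sub>0))) differentiable (at (snd c h))"
    using pair times_differentiable_on_2D(2)[OF \<mu> mem] by (rule differentiable_chain_at)
  then show ?thesis
    unfolding comp_def using ev by (rule differentiable_cong_nhds)
qed

text \<open>Continuity at the identity in operator norm: near the identity an exponential curve has
  velocity close to \<open>x\<close>, with an error relative to \<open>norm x\<close>.\<close>

lemma left_trans_in_id_tendsto:
  "((\<lambda>a. left_trans_in (chart_at G \<one>) (\<psi>\<^sub>0 a)) \<longlongrightarrow> id_blinfun) (nhds e\<^sub>0)"
proof (rule tendsto_componentwise1)
  fix j :: 'e
  have "isCont (\<lambda>a. left_trans_in (chart_at G \<one>) (\<psi>\<^sub>0 a) j) e\<^sub>0"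
    using differentiable_imp_continuous_within[OF left_trans_in_differentiable[OF chart_at]]
    by (simp add: coord_def coord_inv_def)
  from isCont_tendsto_nhds[OF this]
  show "((\<lambda>a. left_trans_in (chart_at G \<one>) (\<psi>\<^sub>0 a) j) \<longlongrightarrow> id_blinfun j) (nhds e\<^sub>0)"
    by (simp add: from_id_coord left_trans_in_id)
qed

text \<open>In the fixed chart at the identity, subtracting the line \<open>t *\<^sub>R x\<close>
  from the curve leaves a velocity of norm at most \<open>e * norm x\<close> for small
  \<open>x\<close>. The mean value inequality over the unit interval turns this into the estimate
  that defines the derivative.\<close>

lemma lie_exp_has_derivative:
  assumes inj: "inj_on (lie_exp G) (ball 0 r)" "r > 0" and cont: "isCont (lie_exp G) 0"
  shows "((\<lambda>x. coord G \<one> (lie_exp G x)) has_derivative (\<lambda>x. x)) (at 0)"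
    and "group_differentiable (lie_exp G) 0"
proof -
  let ?c = "chart_at G \<one>"
  note c = chart_in_atlas[OF chart_at(1)[of \<one>]]
  show *: "((\<lambda>x. coord G \<one> (lie_exp G x)) has_derivative (\<lambda>x. x)) (at 0)"
    unfolding has_derivative_at_alt
  proof (intro conjI bounded_linear_ident allI impI)
    fix e :: real assume "e > 0"
    have coord_cont: "((\<lambda>x. coord G \<one> (lie_exp G x)) \<longlongrightarrow> e\<^sub>0) (nhds 0)"
    proof -
      have "isCont (coord G \<one>) (lie_exp G 0)"
        using isCont_chart[OF c chart_at(2)] by (simp add: lie_exp_zero coord_def)
      from isCont_tendsto_nhds[OF continuous_at_compose[OF cont, unfolded comp_def, OF this]]
      show ?thesis by (simp add: lie_exp_zero)
    qed
    have ev1: "\<forall>\<^sub>F x in nhds 0. norm (left_trans_in ?c (\<psi>\<^sub>0 (coord G \<one> (lie_exp G x))) - id_blinfun) < e"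
      using tendstoD[OF filterlim_compose[OF left_trans_in_id_tendsto coord_cont] \<open>e > 0\<close>]
      by (simp add: dist_norm)
    have ev2: "\<forall>\<^sub>F x in nhds 0. lie_exp G x \<in> fst ?c"
      by (rule isCont_eventually_in_open[OF cont open_chart_dom[OF c]]) (simp add: lie_exp_zero chart_at)
    from eventually_conj[OF ev1 ev2] obtain d where "d > 0" and d: "\<And>x. norm x < d \<Longrightarrow>
        norm (left_trans_in ?c (\<psi>\<^sub>0 (coord G \<one> (lie_exp G x))) - id_blinfun) < e \<and> lie_exp G x \<in> fst ?c"
      unfolding eventually_nhds_metric by auto
    have "norm (coord G \<one> (lie_exp G x) - e\<^sub>0 - x) \<le> e * norm x" if x: "norm x < min d r" for x
    proof -
      obtain \<gamma> where \<gamma>: "exp_curve G x \<gamma>"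
        using exp_curve_exists[OF inj(1)] x by auto
      have exp_t: "lie_exp G (t *\<^sub>R x) = \<gamma> t" for t
        using lie_exp_eq[OF exp_curve_scale[OF \<gamma>, of t]] by simp
      \<comment> \<open>The segment from 0 to \<open>x\<close> stays in the ball of radius
        \<open>d\<close>, so the curve stays where left translation is close to the identity
        operator.\<close>
      have near: "norm (left_trans_in ?c (\<gamma> t) - id_blinfun) < e \<and> \<gamma> t \<in> fst ?c" if "t \<in> {0..1}" for t
      proof -
        have "norm (t *\<^sub>R x) \<le> norm x"
          using that by (simp add: mult_left_le_one_le)
        then have *: "norm (t *\<^sub>R x) < d" using x by simp
        then have "\<gamma> t \<in> fst ?c" using d exp_t by metis
        then have "\<psi>\<^sub>0 (coord G \<one> (\<gamma> t)) = \<gamma> t"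
          by (simp add: coord_def coord_inv_def chart_inv_chart[OF c])
        then show ?thesis using d[OF *] exp_t by simp
      qed
      have deriv: "((\<lambda>t. coord G \<one> (\<gamma> t) - t *\<^sub>R x) has_derivative
          (\<lambda>h. h *\<^sub>R (left_trans_in ?c (\<gamma> t) x - x))) (at t within {0..1})" if t: "t \<in> {0..1}" for t
      proof -
        \<comment> \<open>The curve equation gives the velocity in the chart preferred at
          \<open>\<gamma> t\<close>. Passing through the identity and translating forward again
          gives it in the fixed chart \<open>?c\<close>.\<close>
        have "((\<lambda>b. snd ?c (\<gamma> t \<otimes> \<psi>\<^sub>0 b)) has_derivative left_trans_in ?c (\<gamma> t)) (at (coord G \<one> (inv (\<gamma> t) \<otimes> \<gamma> t)))"
          using left_trans_in_has_derivative[OF chart_at(1)] near[OF t] by simp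
        from has_derivative_compose[OF exp_curve_translated(2)[OF \<gamma>] this]
        have 1: "((\<lambda>s. coord G \<one> (\<gamma> t \<otimes> \<psi>\<^sub>0 (coord G \<one> (inv (\<gamma> t) \<otimes> \<gamma> s)))) has_derivative
            (\<lambda>h. h *\<^sub>R left_trans_in ?c (\<gamma> t) x)) (at t)"
          by (simp add: coord_def blinfun.scaleR_right)
        have "isCont (\<lambda>s. inv (\<gamma> t) \<otimes> \<gamma> s) t"
          by (intro isCont_mult group_differentiable_isCont[OF exp_curve_translated(1)[OF \<gamma>]]) simp
        from filterlim_iff[THEN iffD1, OF isCont_tendsto_nhds[OF this], rule_format, of "\<lambda>h. \<psi>\<^sub>0 (coord G \<one> h) = h"]
        have "\<forall>\<^sub>F s in nhds t. \<psi>\<^sub>0 (coord G \<one> (inv (\<gamma> t) \<otimes> \<gamma> s)) = inv (\<gamma> t) \<otimes> \<gamma> s"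
          using from_id_coord(5) by simp
        then have "\<forall>\<^sub>F s in nhds t. coord G \<one> (\<gamma> t \<otimes> \<psi>\<^sub>0 (coord G \<one> (inv (\<gamma> t) \<otimes> \<gamma> s))) = coord G \<one> (\<gamma> s)"
          by eventually_elim simp
        from has_derivative_cong_nhds[OF 1 this]
        have "((\<lambda>s. coord G \<one> (\<gamma> s)) has_derivative (\<lambda>h. h *\<^sub>R left_trans_in ?c (\<gamma> t) x)) (at t)" .
        then have "((\<lambda>t. coord G \<one> (\<gamma> t) - t *\<^sub>R x) has_derivative (\<lambda>h. h *\<^sub>R (left_trans_in ?c (\<gamma> t) x - x))) (at t)"
          by (auto intro!: derivative_eq_intros simp: scaleR_diff_right)
        then show ?thesis by (rule has_derivative_at_withinI)
      qed
      have "norm ((coord G \<one> (\<gamma> 1) - 1 *\<^sub>R x) - (coord G \<one> (\<gamma> 0) - 0 *\<^sub>R x)) \<le> (e * norm x) * norm (1 - 0 :: real)"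
      proof (rule differentiable_bound[OF _ deriv])
        fix t :: real assume t: "t \<in> {0..1}"
        have "norm (left_trans_in ?c (\<gamma> t) x - x) = norm ((left_trans_in ?c (\<gamma> t) - id_blinfun) x)"
          by (simp add: blinfun.diff_left)
        also have "\<dots> \<le> norm (left_trans_in ?c (\<gamma> t) - id_blinfun) * norm x"
          by (rule norm_blinfun)
        also have "\<dots> \<le> e * norm x"
          using near[OF t] by (intro mult_right_mono) auto
        finally show "onorm (\<lambda>h. h *\<^sub>R (left_trans_in ?c (\<gamma> t) x - x)) \<le> e * norm x"
          by (intro onorm_le) (auto simp: mult.commute[of "e * norm x"] intro!: mult_left_mono)
      qed auto
      moreover have "\<gamma> 0 = \<one>" using \<gamma> by (simp add: exp_curve_def)
      ultimately show ?thesis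
        using exp_t[of 1] by (simp add: algebra_simps)
    qed
    then show "\<exists>d>0. \<forall>y. norm (y - 0) < d \<longrightarrow>
        norm (coord G \<one> (lie_exp G y) - coord G \<one> (lie_exp G 0) - (y - 0)) \<le> e * norm (y - 0)"
      using \<open>d > 0\<close> \<open>r > 0\<close> by (intro exI[of _ "min d r"]) (auto simp: lie_exp_zero)
  qed
  show "group_differentiable (lie_exp G) 0"
    using * by (intro group_differentiableI[OF cont chart_at(1)[of \<one>]]) (auto simp: lie_exp_zero chart_at differentiable_def coord_def)
qed

end

section \<open>Linear algebra of bounded linear maps\<close>

lemma dual_map_apply [simp]: "dual_map A \<phi> x = \<phi> (A x)"
proof -
  have "bounded_linear (\<lambda>\<phi> :: _ \<Rightarrow>\<^sub>L real. \<phi> o\<^sub>L A)"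
    by (rule bounded_bilinear.bounded_linear_left[OF bounded_bilinear_blinfun_compose])
  then show ?thesis
    by (simp add: dual_map_def bounded_linear_Blinfun_apply)
qed

lemma functional_after_apply [simp]: "functional_after V T x y = V (T x y)"
proof -
  have "bounded_linear (\<lambda>x. V o\<^sub>L T x)"
    by (rule bounded_linear_compose[OF bounded_bilinear.bounded_linear_right[OF bounded_bilinear_blinfun_compose]
          blinfun.bounded_linear_right])
  then show ?thesis
    by (simp add: functional_after_def bounded_linear_Blinfun_apply)
qed

text \<open>\<open>Blinfun\<close> needs the inverse to be bounded. By compactness of the unit
  sphere \<open>norm (A x)\<close> attains a minimum there, positive by injectivity, and its
  reciprocal bounds the inverse.\<close>

lemma binv_right:
  fixes A :: "'a::euclidean_space \<Rightarrow>\<^sub>L 'b::real_normed_vector"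
  assumes "bij (blinfun_apply A)"
  shows "A (binv A y) = y"
proof -
  let ?B = "inv_into UNIV (blinfun_apply A)"
  have AB: "A (?B y) = y" for y
    using assms by (simp add: bij_is_surj surj_f_inv_f)
  have BA: "?B (A x) = x" for x
    using assms by (simp add: bij_is_inj)
  obtain m where "m > 0" and m: "\<And>x. m * norm x \<le> norm (A x)"
  proof -
    let ?S = "sphere (0::'a) 1"
    have "?S \<noteq> {}"
      using nonempty_Basis by (auto simp: sphere_eq_empty)
    moreover have "continuous_on ?S (\<lambda>x. norm (A x))"
      by (intro continuous_intros)
    ultimately obtain s where s: "s \<in> ?S" "\<And>x. x \<in> ?S \<Longrightarrow> norm (A s) \<le> norm (A x)"
      using continuous_attains_inf[OF compact_sphere] by blast
    show thesis
    proof
      show "norm (A s) > 0"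
        using s(1) BA[of s] BA[of 0] by (auto simp: blinfun.zero_right)
      show "norm (A s) * norm x \<le> norm (A x)" for x
      proof (cases "x = 0")
        case False
        then have "norm (A s) \<le> norm (A ((1 / norm x) *\<^sub>R x))"
          by (intro s(2)) simp
        then show ?thesis
          using False by (simp add: blinfun.scaleR_right field_simps)
      qed simp
    qed
  qed
  have "bounded_linear ?B"
  proof (rule bounded_linear_intro[where K = "1 / m"])
    show "?B (x + y) = ?B x + ?B y" for x y
      using BA[of "?B x + ?B y"] by (simp add: blinfun.add_right AB)
    show "?B (r *\<^sub>R x) = r *\<^sub>R ?B x" for r x
      using BA[of "r *\<^sub>R ?B x"] by (simp add: blinfun.scaleR_right AB)
    show "norm (?B x) \<le> norm x * (1 / m)" for x
      using m[of "?B x"] \<open>m > 0\<close> by (simp add: AB field_simps)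
  qed
  then show ?thesis
    by (simp add: binv_def bounded_linear_Blinfun_apply AB)
qed

text \<open>Both layers of \<open>Blinfun\<close> evaluate as intended only on bounded linear maps;
  in finite dimension linearity in each variable guarantees this.\<close>

lemma Blinfun_bilinear_apply:
  fixes S :: "'a::euclidean_space \<Rightarrow> 'b::euclidean_space \<Rightarrow> real"
  assumes "\<And>x. linear (S x)" "\<And>y. linear (\<lambda>x. S x y)"
  shows "Blinfun (\<lambda>x. Blinfun (S x)) x y = S x y"
proof -
  have 1: "Blinfun (S x) y = S x y" for x y
    using assms(1) by (simp add: bounded_linear_Blinfun_apply linear_conv_bounded_linear)
  have "linear (\<lambda>x. Blinfun (S x))"
  proof (rule linearI; rule blinfun_eqI)
    show "Blinfun (S (x + y)) z = (Blinfun (S x) + Blinfun (S y)) z" for x y z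
      unfolding blinfun.add_left 1 by (rule linear_add[OF assms(2)])
    show "Blinfun (S (r *\<^sub>R x)) z = (r *\<^sub>R Blinfun (S x)) z" for r x z
      unfolding blinfun.scaleR_left 1 by (rule linear_scale[OF assms(2)])
  qed
  then have "Blinfun (\<lambda>x. Blinfun (S x)) x = Blinfun (S x)"
    unfolding linear_conv_bounded_linear by (subst bounded_linear_Blinfun_apply) simp_all
  then show ?thesis
    by (simp only: 1)
qed

section \<open>Trivialized derivatives of the costs\<close>

context lie_group
begin

text \<open>On a ball around 0 inside \<open>U\<close> the homeomorphism supplies the injectivity
  and continuity on which the derivative of \<open>lie_exp\<close> rests.\<close>

lemma local_logD:
  assumes "local_log G lg"
  shows "group_differentiable (lie_exp G) 0"
    and "((\<lambda>x. coord G \<one> (lie_exp G x)) has_derivative (\<lambda>x. x)) (at 0)"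
    and "lg \<one> = 0"
    and "\<forall>\<^sub>F h in nhds \<one>. lie_exp G (lg h) = h"
proof -
  obtain U V where U: "open U" "0 \<in> U" and V: "open V" "\<one> \<in> V" and hom: "homeomorphism U V (lie_exp G) lg"
    using assms by (auto simp: local_log_def)
  obtain r where "r > 0" and r: "ball 0 r \<subseteq> U"
    using U open_contains_ball by blast
  have "inj_on (lie_exp G) (ball 0 r)"
    by (rule inj_on_inverseI[of _ lg]) (use homeomorphism_apply1[OF hom] r in blast)
  moreover have "isCont (lie_exp G) 0"
    using homeomorphism_cont1[OF hom] U continuous_on_eq_continuous_at by blast
  ultimately show "group_differentiable (lie_exp G) 0"
    "((\<lambda>x. coord G \<one> (lie_exp G x)) has_derivative (\<lambda>x. x)) (at 0)"
    using lie_exp_has_derivative \<open>r > 0\<close> by blast+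
  show "lg \<one> = 0"
    using homeomorphism_apply1[OF hom U(2)] by (simp add: lie_exp_zero)
  show "\<forall>\<^sub>F h in nhds \<one>. lie_exp G (lg h) = h"
    using eventually_nhds_in_open[OF V] by eventually_elim (rule homeomorphism_apply2[OF hom])
qed

text \<open>As the exponential map has derivative the identity at 0, replacing chart coordinates at
  the identity by exponential ones leaves first derivatives unchanged.\<close>

lemma lie_exp_chart_has_derivative:
  assumes log: "local_log G lg" and c: "c \<in> atlas G" "h \<in> fst c"
  shows "((\<lambda>x. snd c (h \<otimes> lie_exp G x)) has_derivative left_trans_in c h) (at 0)"
proof -
  have "((\<lambda>b. snd c (h \<otimes> \<psi>\<^sub>0 b)) has_derivative left_trans_in c h) (at (coord G \<one> (lie_exp G 0)))"
    using left_trans_in_has_derivative[OF c] by (simp add: lie_exp_zero)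
  from has_derivative_compose[OF local_logD(2)[OF log] this]
  have 1: "((\<lambda>x. snd c (h \<otimes> \<psi>\<^sub>0 (coord G \<one> (lie_exp G x)))) has_derivative left_trans_in c h) (at 0)" .
  have "filterlim (lie_exp G) (nhds \<one>) (nhds 0)"
    using isCont_tendsto_nhds[OF group_differentiable_isCont[OF local_logD(1)[OF log]]] by (simp add: lie_exp_zero)
  from filterlim_iff[THEN iffD1, OF this, rule_format, OF from_id_coord(5)]
  have "\<forall>\<^sub>F x in nhds 0. snd c (h \<otimes> \<psi>\<^sub>0 (coord G \<one> (lie_exp G x))) = snd c (h \<otimes> lie_exp G x)"
    by eventually_elim simp
  with 1 show ?thesis
    by (rule has_derivative_cong_nhds)
qed

lemma triv_diff_has_derivative:
  fixes f :: "'g \<Rightarrow> real"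
  assumes log: "local_log G lg"
    and f: "(\<lambda>q. f (coord_inv G h q)) differentiable (at (coord G h h))"
  shows "((\<lambda>x. f (h \<otimes> lie_exp G x)) has_derivative triv_diff G f h) (at 0)"
proof -
  let ?c = "chart_at G h"
  note c = chart_in_atlas[OF chart_at(1)[of h]]
  have "((\<lambda>q. f (chart_inv ?c q)) has_derivative diff_at G f h) (at (snd ?c (h \<otimes> lie_exp G 0)))"
    using has_derivative_fderiv[OF f] by (simp add: diff_at_def comp_def coord_inv_def coord_def lie_exp_zero)
  from has_derivative_compose[OF lie_exp_chart_has_derivative[OF log chart_at] this]
  moreover have "blinfun_apply (triv_diff G f h) = (\<lambda>x. diff_at G f h (left_trans_in ?c h x))"
    by (auto simp: triv_diff_def left_trans_tangent_eq)
  ultimately have 1: "((\<lambda>x. f (chart_inv ?c (snd ?c (h \<otimes> lie_exp G x)))) has_derivative triv_diff G f h) (at 0)"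
    by simp
  have "isCont (\<lambda>x. h \<otimes> lie_exp G x) 0"
    by (intro isCont_mult group_differentiable_isCont[OF local_logD(1)[OF log]]) simp
  then have "\<forall>\<^sub>F x in nhds 0. h \<otimes> lie_exp G x \<in> fst ?c"
    by (rule isCont_eventually_in_open[OF _ open_chart_dom[OF c]]) (simp add: lie_exp_zero chart_at)
  then have "\<forall>\<^sub>F x in nhds 0. f (chart_inv ?c (snd ?c (h \<otimes> lie_exp G x))) = f (h \<otimes> lie_exp G x)"
    by eventually_elim (simp add: chart_inv_chart[OF c])
  with 1 show ?thesis
    by (rule has_derivative_cong_nhds)
qed

section \<open>Left-invariant fields and symmetry of the Hessian\<close>

lemma left_inv_field_in_chart:
  assumes c: "c \<in> atlas G" "h \<in> fst c"
    and f: "\<And>c. c \<in> atlas G \<Longrightarrow> h \<in> fst c \<Longrightarrow> (\<lambda>q. f (chart_inv c q)) differentiable (at (snd c h))"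
  shows "left_inv_field G y f h = fderiv (\<lambda>q. f (chart_inv c q)) (snd c h) (left_trans_in c h y)"
proof -
  \<comment> \<open>For every chart around \<open>h\<close> the expression is the derivative of this
    one chart-free function, so the preferred chart may be replaced by \<open>c\<close>.\<close>
  have "((\<lambda>b. f (h \<otimes> \<psi>\<^sub>0 b)) has_derivative
      (\<lambda>x. fderiv (\<lambda>q. f (chart_inv c q)) (snd c h) (left_trans_in c h x))) (at e\<^sub>0)"
    if "c \<in> atlas G" "h \<in> fst c" for c
    by (rule has_derivative_along_left_trans[OF that has_derivative_fderiv[OF f[OF that]]])
  from has_derivative_unique[OF this[OF c] this[OF chart_at]]
  show ?thesis
    unfolding left_inv_field_def diff_at_def left_trans_tangent_eq comp_def coord_inv_def coord_def by metis
qed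

text \<open>In a fixed chart the field acts by applying the derivative of \<open>f\<close> to a
  differentiable vector field, and both depend differentiably on the point.\<close>

lemma left_inv_field_differentiable:
  fixes f :: "'g \<Rightarrow> real"
  assumes f: "\<And>c. c \<in> atlas G \<Longrightarrow> times_differentiable_on 2 (\<lambda>q. f (chart_inv c q)) (snd c ` fst c)"
    and c: "c \<in> atlas G" "h \<in> fst c"
  shows "(\<lambda>q. left_inv_field G y f (chart_inv c q)) differentiable (at (snd c h))"
proof (rule differentiable_cong_nhds)
  note is_c = chart_in_atlas[OF c(1)]
  have mem: "snd c h \<in> snd c ` fst c"
    using c by blast
  show "(\<lambda>q. fderiv (\<lambda>q. f (chart_inv c q)) q (left_trans_in c (chart_inv c q) y)) differentiable (at (snd c h))"
    by (intro differentiable_blinfun_apply left_trans_in_differentiable c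
        fderiv_differentiable[OF open_chart_image[OF is_c] mem f[OF c(1)]])
  have f1: "(\<lambda>q. f (chart_inv d q)) differentiable (at (snd d p))" if "d \<in> atlas G" "p \<in> fst d" for d p
    using times_differentiable_on_2D(1)[OF f[OF that(1)]] that(2) differentiable_def by blast
  show "\<forall>\<^sub>F q in nhds (snd c h). fderiv (\<lambda>q. f (chart_inv c q)) q (left_trans_in c (chart_inv c q) y)
      = left_inv_field G y f (chart_inv c q)"
    using eventually_nhds_in_open[OF open_chart_image[OF is_c] mem]
  proof eventually_elim
    case (elim q)
    show ?case
      using left_inv_field_in_chart[OF c(1) chart_inv_in[OF is_c elim] f1] chart_chart_inv[OF is_c elim] by simp
  qed
qed

text \<open>The formula in \<^const>\<open>hess0\<close> is visibly symmetric, but \<^const>\<open>Blinfun\<close> returns junk unless it is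
  bilinear, and its additivity rests on the differentiability of \<open>left_inv_field G y f\<close> at \<open>h\<close>.\<close>

lemma triv_hess_symmetric:
  fixes f :: "'g \<Rightarrow> real"
  assumes f: "\<And>c. c \<in> atlas G \<Longrightarrow> times_differentiable_on 2 (\<lambda>q. f (chart_inv c q)) (snd c ` fst c)"
  shows "triv_hess G f h x y = triv_hess G f h y x"
proof -
  let ?T = "left_trans_tangent G h"
  define LL where "LL x y = left_inv_field G x (left_inv_field G y f) h" for x y
  have diff: "(left_inv_field G y f \<circ> coord_inv G h) differentiable (at (coord G h h))" for y
    using left_inv_field_differentiable[OF f chart_at] by (simp add: comp_def coord_def coord_inv_def)
  have lin_f: "left_inv_field G (x + y) f h = left_inv_field G x f h + left_inv_field G y f h"
    "left_inv_field G (r *\<^sub>R x) f h = r * left_inv_field G x f h" for x y r h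
    by (simp_all add: left_inv_field_def blinfun.add_right blinfun.scaleR_right)
  have LL_right: "linear (LL x)" for x
  proof (rule linearI)
    fix y z r
    have "((left_inv_field G (y + z) f \<circ> coord_inv G h) has_derivative
        (\<lambda>w. diff_at G (left_inv_field G y f) h w + diff_at G (left_inv_field G z f) h w)) (at (coord G h h))"
      using has_derivative_add[OF has_derivative_fderiv[OF diff[of y]] has_derivative_fderiv[OF diff[of z]]]
      by (simp add: comp_def lin_f diff_at_def)
    from fderiv_eq[OF this] show "LL x (y + z) = LL x y + LL x z"
      by (simp add: LL_def left_inv_field_def[of _ _ "left_inv_field _ _ _"] diff_at_def)
    have "((left_inv_field G (r *\<^sub>R y) f \<circ> coord_inv G h) has_derivative
        (\<lambda>w. r * diff_at G (left_inv_field G y f) h w)) (at (coord G h h))"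
      using has_derivative_mult_right[OF has_derivative_fderiv[OF diff[of y]], of r]
      by (simp add: comp_def lin_f diff_at_def)
    from fderiv_eq[OF this] show "LL x (r *\<^sub>R y) = r *\<^sub>R LL x y"
      by (simp add: LL_def left_inv_field_def[of _ _ "left_inv_field _ _ _"] diff_at_def)
  qed
  have LL_left: "linear (\<lambda>x. LL x y)" for y
    by (rule linearI) (simp_all add: LL_def left_inv_field_def[of _ _ "left_inv_field _ _ _"]
        blinfun.add_right blinfun.scaleR_right)
  have binv_lin: "linear (blinfun_apply (binv ?T))"
    by (rule bounded_linear.linear[OF blinfun.bounded_linear_right])
  define S where "S v w = (1/2) * (LL (binv ?T v) (binv ?T w) + LL (binv ?T w) (binv ?T v))" for v w
  have S_sym: "S v w = S w v" for v w
    by (simp add: S_def)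
  have S_lin: "linear (S v)" for v
    by (rule linearI) (simp_all add: S_def linear_add[OF LL_right] linear_add[OF LL_left] linear_scale[OF LL_right]
        linear_scale[OF LL_left] blinfun.add_right blinfun.scaleR_right algebra_simps)
  have "hess0 G f h v w = S v w" for v w
  proof -
    have "hess0 G f h = Blinfun (\<lambda>v. Blinfun (S v))"
      by (simp add: hess0_def Let_def S_def[abs_def] LL_def)
    then show ?thesis
      using Blinfun_bilinear_apply[of S, OF S_lin] S_lin by (simp add: S_sym[of _ w for w])
  qed
  then show ?thesis
    by (simp add: triv_hess_def S_sym)
qed

section \<open>Costs depending on state and control\<close>

lemma times_differentiable_map_std:
  assumes "times_differentiable_map n (atlas G) std_atlas f" and c: "c \<in> atlas G"
  shows "times_differentiable_on n (\<lambda>q. f (chart_inv c q)) (snd c ` fst c)"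
  using times_differentiable_on_charts[OF assms(1) c _ chart_in_atlas[OF c] is_chart_std]
  by (simp add: std_atlas_def)

lemma times_differentiable_map_prod_std:
  fixes L :: "'g \<Rightarrow> 'u::euclidean_space \<Rightarrow> real"
  assumes "times_differentiable_map n (prod_atlas (atlas G) std_atlas) std_atlas (\<lambda>(h, u). L h u)"
    and c: "c \<in> atlas G"
  shows "open ((snd c ` fst c) \<times> (UNIV :: 'u set))"
    and "times_differentiable_on n (\<lambda>z. L (chart_inv c (fst z)) (snd z)) ((snd c ` fst c) \<times> UNIV)"
proof -
  show "open ((snd c ` fst c) \<times> (UNIV :: 'u set))"
    by (intro open_Times open_chart_image chart_in_atlas c) simp
  have "{z. fst z \<in> snd c ` fst c} = (snd c ` fst c) \<times> (UNIV :: 'u set)"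
    by auto
  moreover have "times_differentiable_on n (\<lambda>z. L (chart_inv c (fst z)) (snd z)) {z. fst z \<in> snd c ` fst c}"
    using times_differentiable_on_prod_charts[OF assms(1) c _ _ chart_in_atlas[OF c] is_chart_std is_chart_std]
    by (simp add: std_atlas_def chart_inv_std)
  ultimately show "times_differentiable_on n (\<lambda>z. L (chart_inv c (fst z)) (snd z)) ((snd c ` fst c) \<times> UNIV)"
    by (simp only:)
qed

context
  fixes L :: "'g \<Rightarrow> 'u::euclidean_space \<Rightarrow> real"
  assumes L: "times_differentiable_map 2 (prod_atlas (atlas G) std_atlas) std_atlas (\<lambda>(h, u). L h u)"
begin

lemma times_differentiable_on_fst:
  assumes c: "c \<in> atlas G"
  shows "times_differentiable_on 2 (\<lambda>q. L (chart_inv c q) u) (snd c ` fst c)"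
proof -
  note P = times_differentiable_map_prod_std[OF L c]
  have "bounded_linear (\<lambda>q :: 'e. (q, 0 :: 'u))"
    by (intro bounded_linear_Pair bounded_linear_ident bounded_linear_zero)
  from times_differentiable_on_affine[OF P(1) this P(2), of "(0, u)"]
  show ?thesis by (simp add: vimage_def)
qed

lemma times_differentiable_on_snd: "times_differentiable_on 2 (L h) UNIV"
proof -
  let ?c = "chart_at G h"
  note P = times_differentiable_map_prod_std[OF L chart_at(1)[of h]]
  have "bounded_linear (\<lambda>u :: 'u. (0 :: 'e, u))"
    by (intro bounded_linear_Pair bounded_linear_ident bounded_linear_zero)
  from times_differentiable_on_affine[OF P(1) this P(2), of "(snd ?c h, 0)"]
  show ?thesis
    using chart_at(2)[of h] by (simp add: vimage_def chart_inv_chart[OF chart_in_atlas[OF chart_at(1)]])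
qed

lemma cost_gg_symmetric: "cost_gg G L h u x y = cost_gg G L h u y x"
  unfolding cost_gg_def by (rule triv_hess_symmetric[OF times_differentiable_on_fst])

lemma cost_uu_symmetric: "cost_uu L h u v w = cost_uu L h u w v"
  unfolding cost_uu_def by (rule fderiv_fderiv_symmetric[OF open_UNIV UNIV_I times_differentiable_on_snd])

text \<open>In coordinates this is the exchange of mixed partial derivatives, with left translation
  entering only as a fixed direction.\<close>

lemma cost_ug_eq: "cost_ug G L h u v x = cost_gu G L h u x v"
proof -
  let ?c = "chart_at G h"
  note P = times_differentiable_map_prod_std[OF L chart_at(1)[of h]]
  have "(snd ?c h, u) \<in> (snd ?c ` fst ?c) \<times> UNIV"
    using chart_at(2) by auto
  from fderiv_mixed_symmetric[OF P(1) this P(2), of "left_trans_tangent G h x" v]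
  show ?thesis
    by (simp add: cost_ug_def cost_gu_def diff_at_def comp_def coord_def coord_inv_def)
qed

text \<open>The derivative is taken jointly in both arguments, because in the total cost state and
  control vary together with the control sequence.\<close>

lemma cost_has_derivative:
  assumes log: "local_log G lg"
  shows "((\<lambda>z. L (h \<otimes> lie_exp G (fst z)) (u + snd z)) has_derivative
    (\<lambda>z. cost_g G L h u (fst z) + cost_u L h u (snd z))) (at 0)"
proof -
  let ?c = "chart_at G h" and ?T = "left_trans_tangent G h"
  let ?P = "\<lambda>z. L (chart_inv ?c (fst z)) (snd z)"
  let ?D = "frechet_derivative ?P (at (snd ?c h, u))"
  note c = chart_in_atlas[OF chart_at(1)[of h]]
  note P = times_differentiable_map_prod_std[OF L chart_at(1)[of h]]
  have mem: "(snd ?c h, u) \<in> (snd ?c ` fst ?c) \<times> UNIV"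
    using chart_at(2) by auto
  have fst0: "((\<lambda>z :: 'e \<times> 'u. fst z) has_derivative fst) (at 0)"
    by (rule bounded_linear_imp_has_derivative[OF bounded_linear_fst])
  have T: "((\<lambda>x. snd ?c (h \<otimes> lie_exp G x)) has_derivative ?T) (at (fst (0 :: 'e \<times> 'u)))"
    using lie_exp_chart_has_derivative[OF log chart_at] by (simp add: left_trans_tangent_eq)
  have "((\<lambda>z :: 'e \<times> 'u. (snd ?c (h \<otimes> lie_exp G (fst z)), u + snd z)) has_derivative (\<lambda>z. (?T (fst z), snd z))) (at 0)"
    by (intro has_derivative_Pair has_derivative_compose[OF fst0 T]) (auto intro!: derivative_eq_intros)
  moreover have "(?P has_derivative ?D) (at (snd ?c (h \<otimes> lie_exp G (fst (0 :: 'e \<times> 'u))), u + snd (0 :: 'e \<times> 'u)))"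
    using times_differentiable_on_2D(1)[OF P(2) mem] by (simp add: lie_exp_zero)
  ultimately have 1: "((\<lambda>z. ?P (snd ?c (h \<otimes> lie_exp G (fst z)), u + snd z)) has_derivative (\<lambda>z. ?D (?T (fst z), snd z))) (at 0)"
    by (rule has_derivative_compose)
  have lin: "linear ?D"
    using times_differentiable_on_2D(1)[OF P(2) mem] by (rule has_derivative_linear)
  have "?D (?T x, v) = cost_g G L h u x + cost_u L h u v" for x v
  proof -
    have "?D (?T x, v) = ?D (?T x, 0) + ?D (0, v)"
      using linear_add[OF lin, of "(?T x, 0)" "(0, v)"] by simp
    also have "?D (?T x, 0) = cost_g G L h u x"
      using fderiv_fst[OF P(1) mem P(2), of "?T x"]
      by (simp add: cost_g_def triv_diff_def diff_at_def comp_def coord_def coord_inv_def)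
    also have "?D (0, v) = cost_u L h u v"
      using fderiv_snd[OF P(1) mem P(2), of v] by (simp add: cost_u_def chart_inv_chart[OF c] chart_at)
    finally show ?thesis .
  qed
  with 1 have 2: "((\<lambda>z. ?P (snd ?c (h \<otimes> lie_exp G (fst z)), u + snd z)) has_derivative
      (\<lambda>z. cost_g G L h u (fst z) + cost_u L h u (snd z))) (at 0)"
    by simp
  have "isCont (lie_exp G) (fst (0 :: 'e \<times> 'u))"
    using group_differentiable_isCont[OF local_logD(1)[OF log]] by simp
  then have "isCont (\<lambda>z :: 'e \<times> 'u. lie_exp G (fst z)) 0"
    using continuous_at_compose[OF isCont_fst[OF continuous_ident], unfolded comp_def] by blast
  then have "isCont (\<lambda>z :: 'e \<times> 'u. h \<otimes> lie_exp G (fst z)) 0"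
    by (intro isCont_mult) simp_all
  then have "\<forall>\<^sub>F z :: 'e \<times> 'u in nhds 0. h \<otimes> lie_exp G (fst z) \<in> fst ?c"
    by (rule isCont_eventually_in_open[OF _ open_chart_dom[OF c]]) (simp add: lie_exp_zero chart_at)
  then have "\<forall>\<^sub>F z in nhds 0. ?P (snd ?c (h \<otimes> lie_exp G (fst z)), u + snd z) = L (h \<otimes> lie_exp G (fst z)) (u + snd z)"
    by eventually_elim (simp add: chart_inv_chart[OF c])
  with 2 show ?thesis
    by (rule has_derivative_cong_nhds)
qed

end

end

section \<open>Asymptotics of the forward pass\<close>

text \<open>The estimated quantities include vectors in the Lie algebra and in the control space,
  hence the norm and an explicit constant.\<close>

definition O_power :: "nat \<Rightarrow> (real \<Rightarrow> 'a::real_normed_vector) \<Rightarrow> bool"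
  where "O_power n \<phi> \<longleftrightarrow> (\<exists>C. \<forall>\<^sub>F \<gamma> in at_right 0. norm (\<phi> \<gamma>) \<le> C * \<gamma> ^ n)"

lemma eventually_at_right_0_Ioc: "\<forall>\<^sub>F \<gamma> :: real in at_right 0. \<gamma> \<in> {0<..1}"
  unfolding eventually_at_right_field by (intro exI[of _ 1]) auto

lemma O_power_cong:
  assumes "O_power n \<phi>" "\<forall>\<^sub>F \<gamma> in at_right 0. \<phi> \<gamma> = \<psi> \<gamma>"
  shows "O_power n \<psi>"
proof -
  obtain C where "\<forall>\<^sub>F \<gamma> in at_right 0. norm (\<phi> \<gamma>) \<le> C * \<gamma> ^ n"
    using assms(1) by (auto simp: O_power_def)
  with assms(2) have "\<forall>\<^sub>F \<gamma> in at_right 0. norm (\<psi> \<gamma>) \<le> C * \<gamma> ^ n"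
    by eventually_elim simp
  then show ?thesis by (auto simp: O_power_def)
qed

lemma O_power_zero: "O_power n (\<lambda>_. 0)"
  unfolding O_power_def by (intro exI[of _ 0]) simp

lemma O_power_add:
  assumes "O_power n \<phi>" "O_power n \<psi>"
  shows "O_power n (\<lambda>\<gamma>. \<phi> \<gamma> + \<psi> \<gamma>)"
proof -
  obtain C D where "\<forall>\<^sub>F \<gamma> in at_right 0. norm (\<phi> \<gamma>) \<le> C * \<gamma> ^ n" "\<forall>\<^sub>F \<gamma> in at_right 0. norm (\<psi> \<gamma>) \<le> D * \<gamma> ^ n"
    using assms by (auto simp: O_power_def)
  then have "\<forall>\<^sub>F \<gamma> in at_right 0. norm (\<phi> \<gamma> + \<psi> \<gamma>) \<le> (C + D) * \<gamma> ^ n"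
    by eventually_elim (simp add: distrib_right norm_triangle_mono)
  then show ?thesis by (auto simp: O_power_def)
qed

lemma O_power_blinfun:
  assumes "O_power n \<phi>"
  shows "O_power n (\<lambda>\<gamma>. blinfun_apply A (\<phi> \<gamma>))"
proof -
  obtain C where "\<forall>\<^sub>F \<gamma> in at_right 0. norm (\<phi> \<gamma>) \<le> C * \<gamma> ^ n"
    using assms by (auto simp: O_power_def)
  then have "\<forall>\<^sub>F \<gamma> in at_right 0. norm (A (\<phi> \<gamma>)) \<le> (norm A * C) * \<gamma> ^ n"
  proof eventually_elim
    case (elim \<gamma>)
    have "norm (A (\<phi> \<gamma>)) \<le> norm A * norm (\<phi> \<gamma>)"
      by (rule norm_blinfun)
    also have "\<dots> \<le> norm A * (C * \<gamma> ^ n)"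
      using elim by (intro mult_left_mono) auto
    finally show ?case by simp
  qed
  then show ?thesis by (auto simp: O_power_def)
qed

lemma O_power_minus: "O_power n \<phi> \<Longrightarrow> O_power n (\<lambda>\<gamma>. - \<phi> \<gamma>)"
  by (simp add: O_power_def)

lemma O_power_diff: "O_power n \<phi> \<Longrightarrow> O_power n \<psi> \<Longrightarrow> O_power n (\<lambda>\<gamma>. \<phi> \<gamma> - \<psi> \<gamma>)"
  using O_power_add[of n \<phi> "\<lambda>\<gamma>. - \<psi> \<gamma>"] O_power_minus[of n \<psi>] by simp

lemma O_power_sum:
  assumes "\<And>i. i \<in> I \<Longrightarrow> O_power n (\<phi> i)"
  shows "O_power n (\<lambda>\<gamma>. \<Sum>i\<in>I. \<phi> i \<gamma>)"
  using assms by (induction I rule: infinite_finite_induct) (auto intro: O_power_zero O_power_add)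

lemma O_power_scaleR: "O_power (Suc 0) (\<lambda>\<gamma>. \<gamma> *\<^sub>R c)"
  unfolding O_power_def
proof (intro exI)
  show "\<forall>\<^sub>F \<gamma> in at_right 0. norm (\<gamma> *\<^sub>R c) \<le> norm c * \<gamma> ^ Suc 0"
    using eventually_at_right_0_Ioc by eventually_elim simp
qed

lemma O_power_tendsto_0:
  assumes "O_power (Suc 0) \<phi>"
  shows "(\<phi> \<longlongrightarrow> 0) (at_right 0)"
proof -
  obtain C where "\<forall>\<^sub>F \<gamma> in at_right 0. norm (\<phi> \<gamma>) \<le> C * \<gamma> ^ Suc 0"
    using assms by (auto simp: O_power_def)
  then have "\<forall>\<^sub>F \<gamma> in at_right 0. norm (\<phi> \<gamma>) \<le> C * \<gamma>"
    by simp
  moreover have "((\<lambda>\<gamma>. C * \<gamma>) \<longlongrightarrow> 0) (at_right 0)"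
    using tendsto_mult_right_zero[OF tendsto_ident_at] .
  ultimately show ?thesis
    by (rule Lim_null_comparison)
qed

lemma O_power_mono:
  assumes "O_power n \<phi>" "m \<le> n"
  shows "O_power m \<phi>"
proof -
  obtain C where "\<forall>\<^sub>F \<gamma> in at_right 0. norm (\<phi> \<gamma>) \<le> C * \<gamma> ^ n"
    using assms(1) by (auto simp: O_power_def)
  with eventually_at_right_0_Ioc have "\<forall>\<^sub>F \<gamma> in at_right 0. norm (\<phi> \<gamma>) \<le> \<bar>C\<bar> * \<gamma> ^ m"
  proof eventually_elim
    case (elim \<gamma>)
    have "C * \<gamma> ^ n \<le> \<bar>C\<bar> * \<gamma> ^ m"
      using elim(1) assms(2) by (intro mult_mono power_decreasing) auto
    with elim(2) show ?case by linarith
  qed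
  then show ?thesis by (auto simp: O_power_def)
qed

section \<open>Consequences of the second-order Taylor expansion\<close>

lemma taylor2_remainder:
  assumes "taylor2 T \<Phi> B \<Theta> \<Gamma> \<Delta> \<Xi>"
  obtains C where "C \<ge> 0" "\<forall>\<^sub>F z in nhds 0. norm (T (fst z) (snd z) - (\<Phi> (fst z) + B (snd z))) \<le> C * (norm z)\<^sup>2"
proof -
  let ?q = "\<lambda>z. (1/2) *\<^sub>R (\<Theta> (fst z) (fst z) + \<Gamma> (fst z) (snd z) + \<Delta> (snd z) (fst z) + \<Xi> (snd z) (snd z))"
  \<comment> \<open>The 1 bounds the little-o remainder; the rest bounds the quadratic part, with
    its factor one half.\<close>
  let ?C = "1 + (norm \<Theta> + norm \<Gamma> + norm \<Delta> + norm \<Xi>) / 2"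
  have "(\<lambda>(x, v). norm (T x v - (\<Phi> x + B v + (1/2) *\<^sub>R (\<Theta> x x + \<Gamma> x v + \<Delta> v x + \<Xi> v v))))
      \<in> o[nhds (0, 0)](\<lambda>z. norm z ^ 2)"
    using assms unfolding taylor2_def by blast
  from landau_o.smallD[OF this, of 1]
  have "\<forall>\<^sub>F z in nhds 0. norm (T (fst z) (snd z) - (\<Phi> (fst z) + B (snd z) + ?q z)) \<le> (norm z)\<^sup>2"
    by (simp add: case_prod_beta' zero_prod_def)
  then have "\<forall>\<^sub>F z in nhds 0. norm (T (fst z) (snd z) - (\<Phi> (fst z) + B (snd z))) \<le> ?C * (norm z)\<^sup>2"
  proof eventually_elim
    case (elim z)
    have bilinear: "norm (A x y) \<le> norm A * (norm z)\<^sup>2" if "norm x \<le> norm z" "norm y \<le> norm z"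
      for A :: "'x::real_normed_vector \<Rightarrow>\<^sub>L 'y::real_normed_vector \<Rightarrow>\<^sub>L 'w::real_normed_vector" and x y
    proof -
      have "norm (A x y) \<le> norm (A x) * norm y"
        by (rule norm_blinfun)
      also have "\<dots> \<le> (norm A * norm x) * norm y"
        by (intro mult_right_mono norm_blinfun) simp
      also have "\<dots> \<le> norm A * (norm z * norm z)"
        using that by (auto simp: mult.assoc intro!: mult_left_mono mult_mono)
      finally show ?thesis by (simp add: power2_eq_square)
    qed
    have fs: "norm (fst z) \<le> norm z" "norm (snd z) \<le> norm z"
      using norm_fst_le[of "fst z" "snd z"] norm_snd_le[of "snd z" "fst z"] by auto
    have "norm (\<Theta> (fst z) (fst z) + \<Gamma> (fst z) (snd z) + \<Delta> (snd z) (fst z) + \<Xi> (snd z) (snd z))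
        \<le> norm \<Theta> * (norm z)\<^sup>2 + norm \<Gamma> * (norm z)\<^sup>2 + norm \<Delta> * (norm z)\<^sup>2 + norm \<Xi> * (norm z)\<^sup>2"
      by (intro norm_triangle_mono bilinear fs)
    then have "norm (?q z) \<le> ((norm \<Theta> + norm \<Gamma> + norm \<Delta> + norm \<Xi>) / 2) * (norm z)\<^sup>2"
      by (simp only: norm_scaleR) (simp add: distrib_right)
    moreover have "norm (T (fst z) (snd z) - (\<Phi> (fst z) + B (snd z)))
        \<le> norm (T (fst z) (snd z) - (\<Phi> (fst z) + B (snd z) + ?q z)) + norm (?q z)"
      using norm_triangle_ineq[of "T (fst z) (snd z) - (\<Phi> (fst z) + B (snd z) + ?q z)" "?q z"] by (simp add: algebra_simps)
    ultimately show ?case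
      using elim unfolding distrib_right by linarith
  qed
  moreover have "?C \<ge> 0" by (simp add: add_nonneg_nonneg)
  ultimately show ?thesis using that by blast
qed

text \<open>The filter \<open>nhds 0\<close> includes the point 0 itself, where the remainder bound
  forces the norm to vanish.\<close>

lemma taylor2_zero:
  assumes "taylor2 T \<Phi> B \<Theta> \<Gamma> \<Delta> \<Xi>"
  shows "T 0 0 = 0"
proof -
  obtain C where "\<forall>\<^sub>F z in nhds 0. norm (T (fst z) (snd z) - (\<Phi> (fst z) + B (snd z))) \<le> C * (norm z)\<^sup>2"
    using taylor2_remainder[OF assms] .
  from eventually_nhds_x_imp_x[OF this] show ?thesis by simp
qed

lemma taylor2_has_derivative:
  assumes "taylor2 T \<Phi> B \<Theta> \<Gamma> \<Delta> \<Xi>"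
  shows "((\<lambda>z. T (fst z) (snd z)) has_derivative (\<lambda>z. \<Phi> (fst z) + B (snd z))) (at 0)"
  unfolding has_derivative_at_alt
proof (intro conjI allI impI)
  show "bounded_linear (\<lambda>z. \<Phi> (fst z) + B (snd z))"
    by (intro bounded_linear_add bounded_linear_compose[OF blinfun.bounded_linear_right] bounded_linear_fst bounded_linear_snd)
  fix e :: real assume "e > 0"
  obtain C where "C \<ge> 0" and "\<forall>\<^sub>F z in nhds 0. norm (T (fst z) (snd z) - (\<Phi> (fst z) + B (snd z))) \<le> C * (norm z)\<^sup>2"
    using taylor2_remainder[OF assms] .
  then obtain d where "d > 0" and d: "\<And>z. norm z < d \<Longrightarrow> norm (T (fst z) (snd z) - (\<Phi> (fst z) + B (snd z))) \<le> C * (norm z)\<^sup>2"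
    unfolding eventually_nhds_metric by auto
  \<comment> \<open>The radius makes \<open>C * norm z\<close> at most \<open>e\<close>, so the
    quadratic bound becomes a linear one; adding 1 to \<open>C\<close> avoids division by
    zero.\<close>
  have "norm (T (fst z) (snd z) - (\<Phi> (fst z) + B (snd z))) \<le> e * norm z" if "norm z < min d (e / (C + 1))" for z
  proof -
    have "(C + 1) * norm z \<le> e"
      using that \<open>C \<ge> 0\<close> by (simp add: field_simps)
    then have "C * norm z \<le> e"
      using norm_ge_zero[of z] unfolding distrib_right by linarith
    then have "C * (norm z)\<^sup>2 \<le> e * norm z"
      unfolding power2_eq_square mult.assoc[symmetric] by (rule mult_right_mono) simp
    with d[of z] that show ?thesis by simp
  qed
  moreover have "min d (e / (C + 1)) > 0"
    using \<open>d > 0\<close> \<open>e > 0\<close> \<open>C \<ge> 0\<close> by simp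
  ultimately show "\<exists>d>0. \<forall>y. norm (y - 0) < d \<longrightarrow> norm (T (fst y) (snd y) - T (fst 0) (snd 0)
      - (\<Phi> (fst (y - 0)) + B (snd (y - 0)))) \<le> e * norm (y - 0)"
    using taylor2_zero[OF assms] by (metis diff_zero fst_zero snd_zero)
qed

lemma taylor2_O_power:
  assumes "taylor2 T \<Phi> B \<Theta> \<Gamma> \<Delta> \<Xi>" and x: "O_power (Suc 0) x" and v: "O_power (Suc 0) v"
  shows "O_power 2 (\<lambda>\<gamma>. T (x \<gamma>) (v \<gamma>) - (\<Phi> (x \<gamma>) + B (v \<gamma>)))"
proof -
  obtain C where "C \<ge> 0" and rem: "\<forall>\<^sub>F z in nhds 0. norm (T (fst z) (snd z) - (\<Phi> (fst z) + B (snd z))) \<le> C * (norm z)\<^sup>2"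
    using taylor2_remainder[OF assms(1)] .
  have "((\<lambda>\<gamma>. (x \<gamma>, v \<gamma>)) \<longlongrightarrow> 0) (at_right 0)"
    using tendsto_Pair[OF O_power_tendsto_0[OF x] O_power_tendsto_0[OF v]] by (simp add: zero_prod_def)
  from filterlim_iff[THEN iffD1, OF this, rule_format, OF rem]
  have 1: "\<forall>\<^sub>F \<gamma> in at_right 0. norm (T (x \<gamma>) (v \<gamma>) - (\<Phi> (x \<gamma>) + B (v \<gamma>))) \<le> C * (norm (x \<gamma>, v \<gamma>))\<^sup>2"
    by simp
  obtain D E where 2: "\<forall>\<^sub>F \<gamma> in at_right 0. norm (x \<gamma>) \<le> D * \<gamma> ^ Suc 0" "\<forall>\<^sub>F \<gamma> in at_right 0. norm (v \<gamma>) \<le> E * \<gamma> ^ Suc 0"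
    using x v by (auto simp: O_power_def)
  have "\<forall>\<^sub>F \<gamma> in at_right 0. norm (T (x \<gamma>) (v \<gamma>) - (\<Phi> (x \<gamma>) + B (v \<gamma>))) \<le> (C * (D + E)\<^sup>2) * \<gamma> ^ 2"
    using 1 2
  proof eventually_elim
    case (elim \<gamma>)
    have "norm (x \<gamma>, v \<gamma>) \<le> norm (x \<gamma>) + norm (v \<gamma>)"
      by (rule norm_Pair_le)
    also have "\<dots> \<le> (D + E) * \<gamma>"
      using elim by (simp add: distrib_right)
    finally have "(norm (x \<gamma>, v \<gamma>))\<^sup>2 \<le> ((D + E) * \<gamma>)\<^sup>2"
      by (intro power_mono) auto
    then have "C * (norm (x \<gamma>, v \<gamma>))\<^sup>2 \<le> C * ((D + E) * \<gamma>)\<^sup>2"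
      using \<open>C \<ge> 0\<close> by (rule mult_left_mono)
    with elim(1) show ?case by (simp add: power_mult_distrib)
  qed
  then show ?thesis by (auto simp: O_power_def)
qed

section \<open>Symmetric inverses and the linearized recursion\<close>

lemma binv_symmetric_swap:
  fixes A :: "'a::euclidean_space \<Rightarrow>\<^sub>L 'a \<Rightarrow>\<^sub>L real" and \<phi> \<psi> :: "'a \<Rightarrow>\<^sub>L real"
  assumes "bij (blinfun_apply A)" "\<And>x y. A x y = A y x"
  shows "\<phi> (binv A \<psi>) = \<psi> (binv A \<phi>)"
  \<comment> \<open>Symmetry of \<open>A\<close> is used at the two preimages, where each
    application of \<open>A\<close> returns one of the functionals.\<close>
  using assms(2)[of "binv A \<phi>" "binv A \<psi>"] by (simp add: binv_right[OF assms(1)])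

lemma has_derivative_compose_pair:
  assumes T: "((\<lambda>z. T (fst z) (snd z)) has_derivative (\<lambda>z. A (fst z) + C (snd z))) (at 0)"
    and x: "(x has_derivative x') (at p)" and v: "(v has_derivative v') (at p)" and "x p = 0" "v p = 0"
  shows "((\<lambda>s. T (x s) (v s)) has_derivative (\<lambda>d. A (x' d) + C (v' d))) (at p)"
proof -
  have "((\<lambda>z. T (fst z) (snd z)) has_derivative (\<lambda>z. A (fst z) + C (snd z))) (at (x p, v p))"
    using T assms(4,5) by (simp add: zero_prod_def)
  from has_derivative_compose[OF has_derivative_Pair[OF x v] this] show ?thesis
    by simp
qed

text \<open>The initial value 0 expresses that the initial state is fixed and does not vary with the
  controls.\<close>

primrec lin_state :: "(nat \<Rightarrow> 'e::real_normed_vector \<Rightarrow>\<^sub>L 'e) \<Rightarrow>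
    (nat \<Rightarrow> 'u::real_normed_vector \<Rightarrow>\<^sub>L 'e) \<Rightarrow> (nat \<Rightarrow> 'u) \<Rightarrow> nat \<Rightarrow> 'e"
  where
    "lin_state \<Phi> B v 0 = 0"
  | "lin_state \<Phi> B v (Suc k) = \<Phi> k (lin_state \<Phi> B v k) + B k (v k)"

text \<open>Induction on the horizon: the last terminal term splits along \<Phi> and
  \<open>B\<close> and joins the last stage cost to form \<open>Qg\<close> and \<open>Qu\<close>.
  Since \<open>Qg\<close> equals \<open>V\<close> plus \<open>r\<close>, what remains is the
  terminal term of the shorter horizon together with a contribution of \<open>r\<close>.\<close>

lemma lin_state_telescoping:
  assumes "\<And>k. k < n \<Longrightarrow> Qg k = cg k + dual_map (\<Phi> k) (V (Suc k))"
    and "\<And>k. k < n \<Longrightarrow> Qu k = cu k + dual_map (B k) (V (Suc k))"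
    and "\<And>k. k < n \<Longrightarrow> V k = Qg k - r k"
  shows "(\<Sum>k<n. cg k (lin_state \<Phi> B v k) + cu k (v k)) + V n (lin_state \<Phi> B v n)
    = (\<Sum>k<n. Qu k (v k) + r k (lin_state \<Phi> B v k))"
  using assms
proof (induction n)
  case (Suc n)
  let ?\<eta> = "lin_state \<Phi> B v"
  have "Qg n (?\<eta> n) = V n (?\<eta> n) + r n (?\<eta> n)"
    using Suc.prems(3)[of n] by (simp add: blinfun.diff_left)
  moreover have "Qg n (?\<eta> n) = cg n (?\<eta> n) + V (Suc n) (\<Phi> n (?\<eta> n))"
    using Suc.prems(1)[of n] by (simp add: blinfun.add_left)
  moreover have "Qu n (v n) = cu n (v n) + V (Suc n) (B n (v n))"
    using Suc.prems(2)[of n] by (simp add: blinfun.add_left)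
  moreover have "(\<Sum>k<n. cg k (?\<eta> k) + cu k (v k)) + V n (?\<eta> n) = (\<Sum>k<n. Qu k (v k) + r k (?\<eta> k))"
    using Suc by simp
  ultimately show ?case
    by (simp add: blinfun.add_right)
qed (simp add: blinfun.zero_right)

section \<open>The dynamics in exponential coordinates\<close>

context lie_group
begin

text \<open>The filter is arbitrary because the fact is used both for control sequences near the
  nominal one and for \<gamma> tending to 0 from the right.\<close>

lemma exp_log_translated:
  assumes log: "local_log G lg" and lim: "(\<phi> \<longlongrightarrow> p) A"
  shows "\<forall>\<^sub>F s in A. p \<otimes> lie_exp G (lg (inv p \<otimes> \<phi> s)) = \<phi> s"
proof -
  have "isCont (\<lambda>h. inv p \<otimes> h) p"
    by (intro isCont_mult) simp_all
  then have "((\<lambda>s. inv p \<otimes> \<phi> s) \<longlongrightarrow> inv p \<otimes> p) A"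
    using lim by (rule isCont_tendsto_compose)
  then have 1: "((\<lambda>s. inv p \<otimes> \<phi> s) \<longlongrightarrow> \<one>) A"
    by simp
  from filterlim_iff[THEN iffD1, OF 1, rule_format, OF local_logD(4)[OF log]]
  show "\<forall>\<^sub>F s in A. p \<otimes> lie_exp G (lg (inv p \<otimes> \<phi> s)) = \<phi> s"
    by eventually_elim simp
qed

context
  fixes lg :: "'g \<Rightarrow> 'e" and H :: nat and ix :: "nat \<Rightarrow> 'h::finite"
    and f :: "nat \<Rightarrow> 'g \<Rightarrow> 'u::euclidean_space \<Rightarrow> 'g" and gbar :: "nat \<Rightarrow> 'g" and ubar :: "nat \<Rightarrow> 'u"
    and \<Phi> :: "nat \<Rightarrow> 'e \<Rightarrow>\<^sub>L 'e" and B :: "nat \<Rightarrow> 'u \<Rightarrow>\<^sub>L 'e" and \<Theta> \<Gamma> \<Delta> \<Xi>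
  assumes log: "local_log G lg"
    and cont_f: "\<And>k. k < H \<Longrightarrow> continuous_on UNIV (\<lambda>(h, u). f k h u)"
    and nominal_g: "\<And>k. k < H \<Longrightarrow> gbar (Suc k) = f k (gbar k) (ubar k)"
    and expansion: "\<And>k. k < H \<Longrightarrow>
      taylor2 (\<lambda>\<xi> \<upsilon>. lg (inv (gbar (Suc k)) \<otimes> f k (gbar k \<otimes> lie_exp G \<xi>) (ubar k + \<upsilon>)))
        (\<Phi> k) (B k) (\<Theta> k) (\<Gamma> k) (\<Delta> k) (\<Xi> k)"
begin

lemma step_tendsto:
  assumes k: "k < H" and "(h \<longlongrightarrow> gbar k) A" "(u \<longlongrightarrow> ubar k) A"
  shows "((\<lambda>s. f k (h s) (u s)) \<longlongrightarrow> gbar (Suc k)) A"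
proof -
  have "isCont (\<lambda>(h, u). f k h u) (gbar k, ubar k)"
    using cont_f[OF k] by (simp add: continuous_on_eq_continuous_at)
  from isCont_tendsto_compose[OF this tendsto_Pair[OF assms(2,3)]] show ?thesis
    by (simp add: nominal_g[OF k])
qed

text \<open>The three claims are proved by one induction: convergence of the state is what lets it
  be recovered from its logarithm, and its nominal value places the derivative of the next step at
  0.\<close>

lemma
  fixes Ubar :: "'u ^ 'h"
  assumes nominal_u: "\<And>k. k < H \<Longrightarrow> ubar k = Ubar $ ix k" and "k \<le> H"
  shows state_tendsto: "((\<lambda>U. state f (gbar 0) (\<lambda>k. U $ ix k) k) \<longlongrightarrow> gbar k) (nhds Ubar)"
    and state_nominal: "state f (gbar 0) (\<lambda>k. Ubar $ ix k) k = gbar k"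
    and state_log_has_derivative:
      "((\<lambda>U. lg (inv (gbar k) \<otimes> state f (gbar 0) (\<lambda>k. U $ ix k) k)) has_derivative
        (\<lambda>V. lin_state \<Phi> B (\<lambda>k. V $ ix k) k)) (at Ubar)"
proof -
  let ?st = "\<lambda>U. state f (gbar 0) (\<lambda>k. U $ ix k)"
  have "((\<lambda>U. ?st U k) \<longlongrightarrow> gbar k) (nhds Ubar) \<and> ?st Ubar k = gbar k \<and>
    ((\<lambda>U. lg (inv (gbar k) \<otimes> ?st U k)) has_derivative (\<lambda>V. lin_state \<Phi> B (\<lambda>k. V $ ix k) k)) (at Ubar)"
    using \<open>k \<le> H\<close>
  proof (induction k)
    case 0
    then show ?case by simp
  next
    case (Suc k)
    then have k: "k < H" by simp
    let ?z = "\<lambda>U. lg (inv (gbar k) \<otimes> ?st U k)"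
    let ?T = "\<lambda>\<xi> \<upsilon>. lg (inv (gbar (Suc k)) \<otimes> f k (gbar k \<otimes> lie_exp G \<xi>) (ubar k + \<upsilon>))"
    have lim: "((\<lambda>U. ?st U k) \<longlongrightarrow> gbar k) (nhds Ubar)" and st: "?st Ubar k = gbar k"
      and dz: "(?z has_derivative (\<lambda>V. lin_state \<Phi> B (\<lambda>k. V $ ix k) k)) (at Ubar)"
      using Suc k by auto
    have "((\<lambda>U. U $ ix k) \<longlongrightarrow> ubar k) (nhds Ubar)"
      unfolding nominal_u[OF k] by (intro isCont_tendsto_nhds continuous_intros)
    from step_tendsto[OF k lim this]
    have "((\<lambda>U. ?st U (Suc k)) \<longlongrightarrow> gbar (Suc k)) (nhds Ubar)"
      by simp
    moreover have "?st Ubar (Suc k) = gbar (Suc k)"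
      using st nominal_u[OF k] nominal_g[OF k] by simp
    moreover have "((\<lambda>U. lg (inv (gbar (Suc k)) \<otimes> ?st U (Suc k))) has_derivative
      (\<lambda>V. lin_state \<Phi> B (\<lambda>k. V $ ix k) (Suc k))) (at Ubar)"
    proof (rule has_derivative_cong_nhds)
      \<comment> \<open>Near the nominal controls one step of the dynamics, read in these
        coordinates, is exactly \<open>?T\<close>, whose derivative at 0 is given by its
        expansion.\<close>
      show "\<forall>\<^sub>F U in nhds Ubar. ?T (?z U) (U $ ix k - ubar k) = lg (inv (gbar (Suc k)) \<otimes> ?st U (Suc k))"
        using exp_log_translated[OF log lim] by eventually_elim simp
      have "((\<lambda>U. ?T (?z U) (U $ ix k - ubar k)) has_derivative
          (\<lambda>V. \<Phi> k (lin_state \<Phi> B (\<lambda>k. V $ ix k) k) + B k (V $ ix k))) (at Ubar)"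
        by (rule has_derivative_compose_pair[OF taylor2_has_derivative[OF expansion[OF k]] dz])
          (auto intro!: bounded_linear_imp_has_derivative[OF bounded_linear_vec_nth] derivative_eq_intros simp: st local_logD(3)[OF log] nominal_u[OF k])
      then show "((\<lambda>U. ?T (?z U) (U $ ix k - ubar k)) has_derivative
          (\<lambda>V. lin_state \<Phi> B (\<lambda>k. V $ ix k) (Suc k))) (at Ubar)"
        by simp
    qed
    ultimately show ?case by blast
  qed
  then show "((\<lambda>U. ?st U k) \<longlongrightarrow> gbar k) (nhds Ubar)" "?st Ubar k = gbar k"
    "((\<lambda>U. lg (inv (gbar k) \<otimes> ?st U k)) has_derivative (\<lambda>V. lin_state \<Phi> B (\<lambda>k. V $ ix k) k)) (at Ubar)"
    by auto
qed

lemma total_cost_has_derivative: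
  fixes Ubar :: "'u ^ 'h" and \<Lambda> :: "nat \<Rightarrow> 'g \<Rightarrow> 'u \<Rightarrow> real" and F :: "'g \<Rightarrow> real"
  assumes nominal_u: "\<And>k. k < H \<Longrightarrow> ubar k = Ubar $ ix k"
    and \<Lambda>: "\<And>k. k < H \<Longrightarrow>
      times_differentiable_map 2 (prod_atlas (atlas G) std_atlas) std_atlas (\<lambda>(h, u). \<Lambda> k h u)"
    and F: "(\<lambda>q. F (coord_inv G (gbar H) q)) differentiable (at (coord G (gbar H) (gbar H)))"
  shows "(total_cost H ix f \<Lambda> F (gbar 0) has_derivative
    (\<lambda>V. (\<Sum>k<H. cost_g G (\<Lambda> k) (gbar k) (ubar k) (lin_state \<Phi> B (\<lambda>k. V $ ix k) k)
          + cost_u (\<Lambda> k) (gbar k) (ubar k) (V $ ix k))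
        + triv_diff G F (gbar H) (lin_state \<Phi> B (\<lambda>k. V $ ix k) H))) (at Ubar)"
proof -
  let ?st = "\<lambda>U. state f (gbar 0) (\<lambda>k. U $ ix k)"
  let ?z = "\<lambda>k U. lg (inv (gbar k) \<otimes> ?st U k)"
  have st: "((\<lambda>U. ?st U k) \<longlongrightarrow> gbar k) (nhds Ubar)" "?st Ubar k = gbar k"
    "(?z k has_derivative (\<lambda>V. lin_state \<Phi> B (\<lambda>k. V $ ix k) k)) (at Ubar)" if "k \<le> H" for k
    by (rule state_tendsto[OF nominal_u that] state_nominal[OF nominal_u that]
        state_log_has_derivative[OF nominal_u that], assumption)+
  have stage: "((\<lambda>U. \<Lambda> k (?st U k) (U $ ix k)) has_derivative
      (\<lambda>V. cost_g G (\<Lambda> k) (gbar k) (ubar k) (lin_state \<Phi> B (\<lambda>k. V $ ix k) k)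
        + cost_u (\<Lambda> k) (gbar k) (ubar k) (V $ ix k))) (at Ubar)" if k: "k < H" for k
  proof (rule has_derivative_cong_nhds)
    note k' = less_imp_le[OF k]
    show "((\<lambda>U. \<Lambda> k (gbar k \<otimes> lie_exp G (?z k U)) (ubar k + (U $ ix k - ubar k))) has_derivative
      (\<lambda>V. cost_g G (\<Lambda> k) (gbar k) (ubar k) (lin_state \<Phi> B (\<lambda>k. V $ ix k) k)
        + cost_u (\<Lambda> k) (gbar k) (ubar k) (V $ ix k))) (at Ubar)"
      by (rule has_derivative_compose_pair[OF cost_has_derivative[OF \<Lambda>[OF k] log] st(3)[OF k']])
        (auto intro!: bounded_linear_imp_has_derivative[OF bounded_linear_vec_nth] derivative_eq_intros simp: st(2)[OF k'] local_logD(3)[OF log] nominal_u k)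
    show "\<forall>\<^sub>F U in nhds Ubar. \<Lambda> k (gbar k \<otimes> lie_exp G (?z k U)) (ubar k + (U $ ix k - ubar k))
        = \<Lambda> k (?st U k) (U $ ix k)"
      using exp_log_translated[OF log st(1)[OF k']] by eventually_elim simp
  qed
  have "((\<lambda>x. F (gbar H \<otimes> lie_exp G x)) has_derivative triv_diff G F (gbar H)) (at (?z H Ubar))"
    using triv_diff_has_derivative[OF log F] by (simp add: st(2) local_logD(3)[OF log])
  from has_derivative_compose[OF st(3)[OF order_refl] this]
  have 1: "((\<lambda>U. F (gbar H \<otimes> lie_exp G (?z H U))) has_derivative
      (\<lambda>V. triv_diff G F (gbar H) (lin_state \<Phi> B (\<lambda>k. V $ ix k) H))) (at Ubar)"
    by simp
  have final: "((\<lambda>U. F (?st U H)) has_derivative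
      (\<lambda>V. triv_diff G F (gbar H) (lin_state \<Phi> B (\<lambda>k. V $ ix k) H))) (at Ubar)"
    by (rule has_derivative_cong_nhds[OF 1]) (use exp_log_translated[OF log st(1)[OF order_refl]] in eventually_elim, simp)
  have "total_cost H ix f \<Lambda> F (gbar 0) = (\<lambda>U. (\<Sum>k<H. \<Lambda> k (?st U k) (U $ ix k)) + F (?st U H))"
    by (simp add: total_cost_def Let_def fun_eq_iff)
  moreover have "k \<in> {..<H} \<Longrightarrow> k < H" for k
    by simp
  ultimately show ?thesis
    by (simp only:) (intro has_derivative_add has_derivative_sum stage final)
qed

text \<open>The linearized state is driven by the actual update \<open>\<delta> \<gamma>\<close>, so
  its difference from \<open>\<zeta>\<close> is propagated by \<Phi> up to the Taylor remainder. The
  induction also carries convergence of the states, which keeps the logarithm invertible, and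
  first-order smallness of \<open>\<zeta>\<close>, which through the linear feedback
  \<open>K\<close> makes the next update, and hence the remainder, small.\<close>

lemma forward_pass_asymptotics:
  fixes \<delta> :: "real \<Rightarrow> nat \<Rightarrow> 'u" and g :: "real \<Rightarrow> nat \<Rightarrow> 'g" and \<zeta> :: "real \<Rightarrow> nat \<Rightarrow> 'e"
    and a :: "nat \<Rightarrow> 'u" and K :: "nat \<Rightarrow> 'e \<Rightarrow>\<^sub>L 'u"
  assumes update: "\<And>\<gamma> k. \<gamma> \<in> {0<..1} \<Longrightarrow> k < H \<Longrightarrow> \<delta> \<gamma> k = - (\<gamma> *\<^sub>R a k) - K k (\<zeta> \<gamma> k)"
    and g0: "\<And>\<gamma>. \<gamma> \<in> {0<..1} \<Longrightarrow> g \<gamma> 0 = gbar 0"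
    and g: "\<And>\<gamma> k. \<gamma> \<in> {0<..1} \<Longrightarrow> k < H \<Longrightarrow> g \<gamma> (Suc k) = f k (g \<gamma> k) (ubar k + \<delta> \<gamma> k)"
    and \<zeta>0: "\<And>\<gamma>. \<gamma> \<in> {0<..1} \<Longrightarrow> \<zeta> \<gamma> 0 = 0"
    and \<zeta>: "\<And>\<gamma> k. \<gamma> \<in> {0<..1} \<Longrightarrow> k < H \<Longrightarrow> \<zeta> \<gamma> (Suc k) = lg (inv (gbar (Suc k)) \<otimes> g \<gamma> (Suc k))"
    and "k \<le> H"
  shows "O_power 2 (\<lambda>\<gamma>. lin_state \<Phi> B (\<delta> \<gamma>) k - \<zeta> \<gamma> k)"
proof -
  \<comment> \<open>At time 0 both sides vanish because \<open>lg\<close> sends the identity to 0,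
    so the formula also covers the initial state.\<close>
  have \<zeta>_log: "\<zeta> \<gamma> k = lg (inv (gbar k) \<otimes> g \<gamma> k)" if "\<gamma> \<in> {0<..1}" "k \<le> H" for \<gamma> k
    using that g0[OF that(1)] \<zeta>0[OF that(1)] \<zeta>[OF that(1), of "k - 1"] local_logD(3)[OF log]
    by (cases k) auto
  have "((\<lambda>\<gamma>. g \<gamma> k) \<longlongrightarrow> gbar k) (at_right 0) \<and> O_power (Suc 0) (\<lambda>\<gamma>. \<zeta> \<gamma> k) \<and>
      O_power 2 (\<lambda>\<gamma>. lin_state \<Phi> B (\<delta> \<gamma>) k - \<zeta> \<gamma> k)"
    using \<open>k \<le> H\<close>
  proof (induction k)
    case 0
    have "\<forall>\<^sub>F \<gamma> in at_right 0. gbar 0 = g \<gamma> 0" and z: "\<forall>\<^sub>F \<gamma> in at_right 0. 0 = \<zeta> \<gamma> 0"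
      using eventually_at_right_0_Ioc by (eventually_elim, simp add: g0 \<zeta>0)+
    then have "((\<lambda>\<gamma>. g \<gamma> 0) \<longlongrightarrow> gbar 0) (at_right 0)"
      by (intro Lim_transform_eventually[OF tendsto_const])
    with z show ?case
      using O_power_cong[OF O_power_zero z] O_power_minus[OF O_power_cong[OF O_power_zero z]] by simp
  next
    case (Suc k)
    then have k: "k < H" by simp
    let ?T = "\<lambda>\<xi> \<upsilon>. lg (inv (gbar (Suc k)) \<otimes> f k (gbar k \<otimes> lie_exp G \<xi>) (ubar k + \<upsilon>))"
    have lim: "((\<lambda>\<gamma>. g \<gamma> k) \<longlongrightarrow> gbar k) (at_right 0)" and z1: "O_power (Suc 0) (\<lambda>\<gamma>. \<zeta> \<gamma> k)"
      and z2: "O_power 2 (\<lambda>\<gamma>. lin_state \<Phi> B (\<delta> \<gamma>) k - \<zeta> \<gamma> k)"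
      using Suc k by auto
    have \<delta>1: "O_power (Suc 0) (\<lambda>\<gamma>. \<delta> \<gamma> k)"
      by (rule O_power_cong[OF O_power_diff[OF O_power_minus[OF O_power_scaleR[of "a k"]] O_power_blinfun[OF z1, of "K k"]]])
        (use eventually_at_right_0_Ioc in eventually_elim, simp add: update[OF _ k])
    have "((\<lambda>\<gamma>. ubar k + \<delta> \<gamma> k) \<longlongrightarrow> ubar k) (at_right 0)"
      using tendsto_add[OF tendsto_const O_power_tendsto_0[OF \<delta>1]] by force
    from step_tendsto[OF k lim this]
    have lim': "((\<lambda>\<gamma>. g \<gamma> (Suc k)) \<longlongrightarrow> gbar (Suc k)) (at_right 0)"
      by (rule Lim_transform_eventually) (use eventually_at_right_0_Ioc in eventually_elim, simp add: g[OF _ k])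
    have \<zeta>_T: "\<forall>\<^sub>F \<gamma> in at_right 0. ?T (\<zeta> \<gamma> k) (\<delta> \<gamma> k) = \<zeta> \<gamma> (Suc k)"
      using exp_log_translated[OF log lim] eventually_at_right_0_Ioc
      by eventually_elim (simp add: \<zeta>_log[OF _ less_imp_le[OF k]] \<zeta>[OF _ k] g[OF _ k])
    have rem: "O_power 2 (\<lambda>\<gamma>. \<zeta> \<gamma> (Suc k) - (\<Phi> k (\<zeta> \<gamma> k) + B k (\<delta> \<gamma> k)))"
      by (rule O_power_cong[OF taylor2_O_power[OF expansion[OF k] z1 \<delta>1]])
        (use \<zeta>_T in eventually_elim, simp)
    have "O_power (Suc 0) (\<lambda>\<gamma>. \<zeta> \<gamma> (Suc k) - (\<Phi> k (\<zeta> \<gamma> k) + B k (\<delta> \<gamma> k)) + (\<Phi> k (\<zeta> \<gamma> k) + B k (\<delta> \<gamma> k)))"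
      by (intro O_power_add O_power_blinfun z1 \<delta>1 O_power_mono[OF rem]) simp
    then have "O_power (Suc 0) (\<lambda>\<gamma>. \<zeta> \<gamma> (Suc k))"
      by simp
    moreover have "O_power 2 (\<lambda>\<gamma>. \<Phi> k (lin_state \<Phi> B (\<delta> \<gamma>) k - \<zeta> \<gamma> k) - (\<zeta> \<gamma> (Suc k) - (\<Phi> k (\<zeta> \<gamma> k) + B k (\<delta> \<gamma> k))))"
      by (intro O_power_diff O_power_blinfun z2 rem)
    then have "O_power 2 (\<lambda>\<gamma>. lin_state \<Phi> B (\<delta> \<gamma>) (Suc k) - \<zeta> \<gamma> (Suc k))"
      by (simp add: blinfun.diff_right algebra_simps)
    ultimately show ?case
      using lim' by blast
  qed
  then show ?thesis by blast
qed

end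

end

section \<open>Symmetry of the backward pass and the first-order change of the cost\<close>

theorem theoremV1:
  fixes G :: "('g::{t2_space, second_countable_topology}, 'e::euclidean_space) lie_group_data"
    and lg :: "'g \<Rightarrow> 'e"
    and H :: nat
    and ix :: "nat \<Rightarrow> 'h::finite"
    and f :: "nat \<Rightarrow> 'g \<Rightarrow> (real ^ 'm) \<Rightarrow> 'g"
    and \<Lambda> :: "nat \<Rightarrow> 'g \<Rightarrow> (real ^ 'm) \<Rightarrow> real"
    and F :: "'g \<Rightarrow> real"
    and gbar :: "nat \<Rightarrow> 'g"
    and Ubar :: "(real ^ 'm) ^ 'h"
    and ubar :: "nat \<Rightarrow> (real ^ 'm)"
    and \<Phi> :: "nat \<Rightarrow> 'e \<Rightarrow>\<^sub>L 'e"
    and B :: "nat \<Rightarrow> (real ^ 'm) \<Rightarrow>\<^sub>L 'e"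
    and \<Theta> :: "nat \<Rightarrow> 'e \<Rightarrow>\<^sub>L 'e \<Rightarrow>\<^sub>L 'e"
    and \<Gamma> :: "nat \<Rightarrow> 'e \<Rightarrow>\<^sub>L (real ^ 'm) \<Rightarrow>\<^sub>L 'e"
    and \<Delta> :: "nat \<Rightarrow> (real ^ 'm) \<Rightarrow>\<^sub>L 'e \<Rightarrow>\<^sub>L 'e"
    and \<Xi> :: "nat \<Rightarrow> (real ^ 'm) \<Rightarrow>\<^sub>L (real ^ 'm) \<Rightarrow>\<^sub>L 'e"
    and Vg Qg :: "nat \<Rightarrow> 'e \<Rightarrow>\<^sub>L real"
    and Qu :: "nat \<Rightarrow> (real ^ 'm) \<Rightarrow>\<^sub>L real"
    and Vgg Qgg :: "nat \<Rightarrow> 'e \<Rightarrow>\<^sub>L 'e \<Rightarrow>\<^sub>L real"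
    and Qgu :: "nat \<Rightarrow> 'e \<Rightarrow>\<^sub>L (real ^ 'm) \<Rightarrow>\<^sub>L real"
    and Qug :: "nat \<Rightarrow> (real ^ 'm) \<Rightarrow>\<^sub>L 'e \<Rightarrow>\<^sub>L real"
    and Quu :: "nat \<Rightarrow> (real ^ 'm) \<Rightarrow>\<^sub>L (real ^ 'm) \<Rightarrow>\<^sub>L real"
    and \<delta>U :: "real \<Rightarrow> (real ^ 'm) ^ 'h"
    and g :: "real \<Rightarrow> nat \<Rightarrow> 'g"
    and \<zeta> :: "real \<Rightarrow> nat \<Rightarrow> 'e"
  defines "J \<equiv> total_cost H ix f \<Lambda> F (gbar 0)"
  assumes lie: "lie_group G" and log: "local_log G lg"
    and horizon: "bij_betw ix {..<H} UNIV"
    and diff_f: "\<And>k. k < H \<Longrightarrow>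
      times_differentiable_map 2 (prod_atlas (atlas G) std_atlas) (atlas G) (\<lambda>(h, u). f k h u)"
    and diff_\<Lambda>: "\<And>k. k < H \<Longrightarrow>
      times_differentiable_map 2 (prod_atlas (atlas G) std_atlas) std_atlas (\<lambda>(h, u). \<Lambda> k h u)"
    and diff_F: "times_differentiable_map 2 (atlas G) std_atlas F"
    and solution: "\<exists>U. \<forall>U'. J U \<le> J U'"
    and nominal_u: "\<And>k. k < H \<Longrightarrow> ubar k = Ubar $ ix k"
    and nominal_g: "\<And>k. k < H \<Longrightarrow> gbar (Suc k) = f k (gbar k) (ubar k)"
    and expansion: "\<And>k. k < H \<Longrightarrow>
      taylor2 (\<lambda>\<xi> \<upsilon>. lg (inv\<^bsub>G\<^esub> (gbar (Suc k)) \<otimes>\<^bsub>G\<^esub> f k (gbar k \<otimes>\<^bsub>G\<^esub> lie_exp G \<xi>) (ubar k + \<upsilon>)))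
        (\<Phi> k) (B k) (\<Theta> k) (\<Gamma> k) (\<Delta> k) (\<Xi> k)"
    and Vg_H: "Vg H = triv_diff G F (gbar H)"
    and Vgg_H: "Vgg H = triv_hess G F (gbar H)"
    and Qg: "\<And>k. k < H \<Longrightarrow>
      Qg k = cost_g G (\<Lambda> k) (gbar k) (ubar k) + dual_map (\<Phi> k) (Vg (Suc k))"
    and Qu: "\<And>k. k < H \<Longrightarrow>
      Qu k = cost_u (\<Lambda> k) (gbar k) (ubar k) + dual_map (B k) (Vg (Suc k))"
    and Qgg: "\<And>k. k < H \<Longrightarrow>
      Qgg k = cost_gg G (\<Lambda> k) (gbar k) (ubar k)
        + (dual_map (\<Phi> k) o\<^sub>L Vgg (Suc k) o\<^sub>L \<Phi> k) + functional_after (Vg (Suc k)) (\<Theta> k)"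
    and Qgu: "\<And>k. k < H \<Longrightarrow>
      Qgu k = cost_gu G (\<Lambda> k) (gbar k) (ubar k)
        + (dual_map (B k) o\<^sub>L Vgg (Suc k) o\<^sub>L \<Phi> k) + functional_after (Vg (Suc k)) (\<Gamma> k)"
    and Qug: "\<And>k. k < H \<Longrightarrow>
      Qug k = cost_ug G (\<Lambda> k) (gbar k) (ubar k)
        + (dual_map (\<Phi> k) o\<^sub>L Vgg (Suc k) o\<^sub>L B k) + functional_after (Vg (Suc k)) (\<Delta> k)"
    and Quu: "\<And>k. k < H \<Longrightarrow>
      Quu k = cost_uu (\<Lambda> k) (gbar k) (ubar k)
        + (dual_map (B k) o\<^sub>L Vgg (Suc k) o\<^sub>L B k) + functional_after (Vg (Suc k)) (\<Xi> k)"
    and Vg: "\<And>k. k < H \<Longrightarrow> Vg k = Qg k - Qug k (binv (Quu k) (Qu k))"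
    and Vgg: "\<And>k. k < H \<Longrightarrow> Vgg k = Qgg k - (Qug k o\<^sub>L binv (Quu k) o\<^sub>L Qgu k)"
    and Quu_invertible: "\<And>k. k < H \<Longrightarrow> bij (blinfun_apply (Quu k))"
    and update: "\<And>\<gamma> k. \<gamma> \<in> {0<..1} \<Longrightarrow> k < H \<Longrightarrow>
      \<delta>U \<gamma> $ ix k = - (\<gamma> *\<^sub>R binv (Quu k) (Qu k)) - binv (Quu k) (Qgu k (\<zeta> \<gamma> k))"
    and forward_g0: "\<And>\<gamma>. \<gamma> \<in> {0<..1} \<Longrightarrow> g \<gamma> 0 = gbar 0"
    and forward_g: "\<And>\<gamma> k. \<gamma> \<in> {0<..1} \<Longrightarrow> k < H \<Longrightarrow>
      g \<gamma> (Suc k) = f k (g \<gamma> k) (ubar k + \<delta>U \<gamma> $ ix k)"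
    and forward_\<zeta>0: "\<And>\<gamma>. \<gamma> \<in> {0<..1} \<Longrightarrow> \<zeta> \<gamma> 0 = 0"
    and forward_\<zeta>: "\<And>\<gamma> k. \<gamma> \<in> {0<..1} \<Longrightarrow> k < H \<Longrightarrow>
      \<zeta> \<gamma> (Suc k) = lg (inv\<^bsub>G\<^esub> (gbar (Suc k)) \<otimes>\<^bsub>G\<^esub> g \<gamma> (Suc k))"
  shows "(\<lambda>\<gamma>. frechet_derivative J (at Ubar) (\<delta>U \<gamma>)
            - (- \<gamma> * (\<Sum>i<H. Qu i (binv (Quu i) (Qu i)))))
         \<in> O[at_right 0](\<lambda>\<gamma>. \<gamma> ^ 2)"
proof -
  interpret lie_group G by (fact lie)
  let ?a = "\<lambda>k. binv (Quu k) (Qu k)"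
  let ?\<eta> = "\<lambda>\<gamma>. lin_state \<Phi> B (\<lambda>k. \<delta>U \<gamma> $ ix k)"
  have C2_F: "times_differentiable_on 2 (\<lambda>q. F (chart_inv c q)) (snd c ` fst c)" if "c \<in> atlas G" for c
    using times_differentiable_map_std[OF diff_F that] .
  have F: "(\<lambda>q. F (coord_inv G (gbar H) q)) differentiable (at (coord G (gbar H) (gbar H)))"
    using times_differentiable_on_2D(1)[OF C2_F[OF chart_at(1)]] chart_at(2)[of "gbar H"]
    unfolding differentiable_def coord_def coord_inv_def by blast
  have cont_f: "continuous_on UNIV (\<lambda>(h, u). f k h u)" if "k < H" for k
    using diff_f[OF that] by (simp add: times_differentiable_map_def)

  \<comment> \<open>Symmetry of \<open>Vgg\<close> at the next time is kept as a premise, since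
    inside the backward induction it is available only as the induction hypothesis.\<close>
  have Quu_sym_step: "Quu k v w = Quu k w v" if "k < H" "\<And>x y. Vgg (Suc k) x y = Vgg (Suc k) y x" for k v w
  proof -
    have "\<Xi> k v w = \<Xi> k w v"
      using expansion[OF that(1)] unfolding taylor2_def by blast
    then show ?thesis
      using that(2) cost_uu_symmetric[OF diff_\<Lambda>[OF that(1)]] by (simp add: Quu[OF that(1)] blinfun.add_left)
  qed
  have Qug_eq: "Qug k v x = Qgu k x v" if "k < H" "\<And>x y. Vgg (Suc k) x y = Vgg (Suc k) y x" for k v x
  proof -
    have "\<Delta> k v x = \<Gamma> k x v"
      using expansion[OF that(1)] unfolding taylor2_def by blast
    then show ?thesis
      using that(2)[of "B k v"] cost_ug_eq[OF diff_\<Lambda>[OF that(1)]]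
      by (simp add: Qug[OF that(1)] Qgu[OF that(1)] blinfun.add_left)
  qed
  \<comment> \<open>\<open>inc_induct\<close> runs backwards in time, from the terminal Hessian at
    \<open>H\<close> down to \<open>k\<close>.\<close>
  have Vgg_sym: "Vgg k x y = Vgg k y x" if "k \<le> H" for k x y
    using that
  proof (induction k arbitrary: x y rule: inc_induct)
    case base
    show ?case
      unfolding Vgg_H by (rule triv_hess_symmetric[OF C2_F])
  next
    case (step k)
    have "\<Theta> k x y = \<Theta> k y x"
      using expansion[OF step(2)] unfolding taylor2_def by blast
    then have "Qgg k x y = Qgg k y x"
      using step.IH cost_gg_symmetric[OF diff_\<Lambda>[OF step(2)]] by (simp add: Qgg[OF step(2)] blinfun.add_left)
    \<comment> \<open>With \<open>Qug\<close> dual to \<open>Qgu\<close>, the term subtracted from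
      \<open>Qgg\<close> is the inverse form of \<open>Quu\<close> evaluated at two values of
      \<open>Qgu\<close>, hence symmetric.\<close>
    moreover have "Qug k (binv (Quu k) (Qgu k x)) y = Qug k (binv (Quu k) (Qgu k y)) x"
      unfolding Qug_eq[OF step(2,3)]
      by (rule binv_symmetric_swap[OF Quu_invertible[OF step(2)] Quu_sym_step[OF step(2,3)]])
    ultimately show ?case
      by (simp add: Vgg[OF step(2)] blinfun.diff_left)
  qed
  \<comment> \<open>The feedback gain paired with \<open>Qu\<close> equals the functional by which
    \<open>Vg\<close> falls short of \<open>Qg\<close>. This is the cancellation between feedback
    and backward pass.\<close>
  have gain_swap: "Qu k (binv (Quu k) (Qgu k x)) = Qug k (?a k) x" if "k < H" for k x
    unfolding Qug_eq[OF that Vgg_sym[OF Suc_leI[OF that]]]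
    by (rule binv_symmetric_swap[OF Quu_invertible[OF that] Quu_sym_step[OF that Vgg_sym[OF Suc_leI[OF that]]]])

  have "(J has_derivative (\<lambda>W. (\<Sum>k<H. cost_g G (\<Lambda> k) (gbar k) (ubar k) (lin_state \<Phi> B (\<lambda>k. W $ ix k) k)
          + cost_u (\<Lambda> k) (gbar k) (ubar k) (W $ ix k))
        + triv_diff G F (gbar H) (lin_state \<Phi> B (\<lambda>k. W $ ix k) H))) (at Ubar)"
    unfolding J_def
    by (rule total_cost_has_derivative[OF log cont_f nominal_g expansion nominal_u diff_\<Lambda> F]) assumption+
  \<comment> \<open>The correction \<open>r\<close> in the telescoping identity is
    \<open>Qug k (?a k)\<close>, the difference between \<open>Qg\<close> and
    \<open>Vg\<close>.\<close>
  from frechet_derivative_at[OF this]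
  have DJ: "frechet_derivative J (at Ubar) W
      = (\<Sum>k<H. Qu k (W $ ix k) + Qug k (?a k) (lin_state \<Phi> B (\<lambda>k. W $ ix k) k))" for W
    using lin_state_telescoping[of H Qg _ \<Phi> Vg Qu _ B "\<lambda>k. Qug k (?a k)", OF Qg Qu Vg]
    by (simp add: Vg_H fun_eq_iff)
  \<comment> \<open>An exact identity for each admissible \<gamma>: the open-loop part of the update
    produces the claimed main term, and the feedback part replaces the linearized state by its
    difference from \<open>\<zeta>\<close>.\<close>
  have remainder: "frechet_derivative J (at Ubar) (\<delta>U \<gamma>) - (- \<gamma> * (\<Sum>i<H. Qu i (?a i)))
      = (\<Sum>k<H. Qug k (?a k) (?\<eta> \<gamma> k - \<zeta> \<gamma> k))" if "\<gamma> \<in> {0<..1}" for \<gamma>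
  proof -
    have "Qu k (\<delta>U \<gamma> $ ix k) = - \<gamma> * Qu k (?a k) - Qug k (?a k) (\<zeta> \<gamma> k)" if "k < H" for k
      using update[OF \<open>\<gamma> \<in> {0<..1}\<close> that] gain_swap[OF that]
      by (simp add: blinfun.diff_right blinfun.minus_right blinfun.scaleR_right)
    then show ?thesis
      unfolding DJ by (simp add: blinfun.diff_right sum_distrib_left sum_subtractf sum.distrib sum_negf)
  qed

  have "O_power 2 (\<lambda>\<gamma>. ?\<eta> \<gamma> k - \<zeta> \<gamma> k)" if "k \<le> H" for k
    by (rule forward_pass_asymptotics[where lg = lg and f = f and gbar = gbar and H = H and ubar = ubar
          and a = ?a and K = "\<lambda>k. binv (Quu k) o\<^sub>L Qgu k" and g = g])
      (((rule log cont_f nominal_g expansion forward_g0 forward_g forward_\<zeta>0 forward_\<zeta> that; assumption)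
        | simp add: update)+)
  then have "O_power 2 (\<lambda>\<gamma>. \<Sum>k<H. Qug k (?a k) (?\<eta> \<gamma> k - \<zeta> \<gamma> k))"
    by (intro O_power_sum O_power_blinfun) simp
  then have "O_power 2 (\<lambda>\<gamma>. frechet_derivative J (at Ubar) (\<delta>U \<gamma>) - (- \<gamma> * (\<Sum>i<H. Qu i (?a i))))"
    by (rule O_power_cong) (use eventually_at_right_0_Ioc in eventually_elim, simp only: remainder)
  then obtain C where "\<forall>\<^sub>F \<gamma> in at_right 0.
      norm (frechet_derivative J (at Ubar) (\<delta>U \<gamma>) - (- \<gamma> * (\<Sum>i<H. Qu i (?a i)))) \<le> C * \<gamma> ^ 2"
    unfolding O_power_def by blast
  then have "\<forall>\<^sub>F \<gamma> in at_right 0.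
      norm (frechet_derivative J (at Ubar) (\<delta>U \<gamma>) - (- \<gamma> * (\<Sum>i<H. Qu i (?a i)))) \<le> C * norm (\<gamma> ^ 2)"
    by eventually_elim simp
  then show ?thesis
    by (rule bigoI)
qed

end
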